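(* Let $n\ge3$ be an odd integer, $T\ge0$ and $J\ge1$ integers with $J<n/2$, and let $X_t(\theta)=\Gamma(\theta)+N_t(\theta)$, $t=0,\dots,T$, be the perfectly aligned noisy curve model described in the context, observed at $\theta_l=-(n+1)\pi/n+2\pi l/n$, $l=1,\dots,n$, giving $X_t^l=X_t(\theta_l)$. Let $$\widehat{\Gamma_n}(\theta)=\frac1{T+1}\sum_{t=0}^T\sum_{l=1}^nX_t^l\,S_l(\theta),\qquad S_l(\theta)=\frac1n+\frac2n\sum_{j=1}^J\cos(j(\theta-\theta_l)),\quad\theta\in[-\pi,\pi].$$ Put $\sigma_{0,n}^2=\frac1n\sum_{l=1}^n\rho(\theta_l)$ and $\sigma_{j,n}^2=\frac2n\sum_{l=1}^n\rho(\theta_l)\cos(j\theta_l)$ for $j\ge1$, and assume $\sigma_{j,n}^2>0$ for $j=0,\dots,J$. Then $$\frac1\pi\int_{-\pi}^\pi\|\widehat{\Gamma_n}(\theta)-\Gamma(\theta)\|^2\,d\theta=\sum_{j=J+1}^\infty\left[\|\mu_j\|^2+\|\nu_j\|^2\right]+Z,\qquad Z=\frac1{T+1}\Big(2\sigma_{0,n}^2Z_{0,n}+\sum_{j=1}^J\sigma_{j,n}^2Z_{j,n}\Big),$$ where $Z_{0,n},\dots,Z_{J,n}$ are independent (non-central) $\chi^2$ distributed random variables, with four degrees of freedom for $j\ge1$ and two for $j=0$, and non-centrality parameters $(T+1)c_{j,n}/\sigma_{j,n}^2$, where $$c_{j,n}=\|\mu_{j,n}-\mu_j\|^2+\|\nu_{j,n}-\nu_j\|^2,\quad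 j=1,\dots,J,\qquad c_{0,n}=\|\mu_{0,n}-\mu_0\|^2.$$ Moreover, $Z\to2c_{0,n}+\sum_{j=1}^Jc_{j,n}$ almost surely as $T\to\infty$ (with $n$ and $J$ fixed).
   Context: Model. $\Gamma=(\Gamma_1,\Gamma_2):[-\pi,\pi]\to\mathbb{R}^2$ is a $C^1$ function with $\Gamma(-\pi)=\Gamma(\pi)$. Its Fourier coefficients are $\mu_0=\frac1{2\pi}\int_{-\pi}^\pi\Gamma(\theta)\,d\theta$, $\mu_j=\frac1\pi\int_{-\pi}^\pi\Gamma(\theta)\cos(j\theta)\,d\theta$, $\nu_j=\frac1\pi\int_{-\pi}^\pi\Gamma(\theta)\sin(j\theta)\,d\theta$, $j\in\mathbb{N}=\{1,2,\dots\}$ (componentwise). Their Riemann sum approximations are $\mu_{0,n}=\frac1n\sum_{l=1}^n\Gamma(\theta_l)$, $\mu_{j,n}=\frac2n\sum_{l=1}^n\Gamma(\theta_l)\cos(j\theta_l)$, $\nu_{j,n}=\frac2n\sum_{l=1}^n\Gamma(\theta_l)\sin(j\theta_l)$. Noise. The processes $N_t=(N_{t,1},N_{t,2})$, $t=0,1,2,\dots$, are independent over $t$, with $N_{t,i}(\theta)=\sum_{j=0}^\infty[A_{j,i}^t\cos(j\theta)+B_{j,i}^t\sin(j\theta)]$, $i=1,2$, where all $A_{j,i}^t,B_{j,i}^t$ are mutually independent zero-mean Gaussian random variables, $A^t_{j,i}$ and $B^t_{j,i}$ having variance $\sigma_j^2$, and for some $\epsilon>0$, $\sum_{j\ge1}j^{2+\epsilon}\sigma_j^2<\infty$.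 The $N_{t,i}$ are taken in their continuously differentiable version. Each $N_{t,i}$ has covariance function $\rho(\theta)=\sum_{j=0}^\infty\sigma_j^2\cos(j\theta)$, i.e. $\mathrm{Cov}(N_{t,i}(\theta),N_{t,i}(\eta))=\rho(\eta-\theta)$. A non-central $\chi^2$ variable with $k$ degrees of freedom and non-centrality parameter $\lambda$ is the law of $\sum_{i=1}^kY_i^2$ with independent $Y_i\sim N(m_i,1)$ and $\lambda=\sum_im_i^2$. $\|\cdot\|$ is the Euclidean norm. *)

theory Defs
  imports "HOL-Probability.Probability"
begin

(* At the boundary points of S the derivative is one-sided, so nothing is required of f
   outside S (unlike the library's C1_differentiable_on). *)
definition C1_within :: "real set \<Rightarrow> (real \<Rightarrow> 'a::real_normed_vector) \<Rightarrow> bool" where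
  "C1_within S f \<longleftrightarrow>
     (\<exists>D. (\<forall>x\<in>S. (f has_vector_derivative D x) (at x within S)) \<and> continuous_on S D)"

definition fourier_cos :: "(real \<Rightarrow> real^2) \<Rightarrow> nat \<Rightarrow> real^2" where
  "fourier_cos \<Gamma> j =
     (if j = 0 then (1 / (2 * pi)) *\<^sub>R integral {-pi..pi} \<Gamma>
      else (1 / pi) *\<^sub>R integral {-pi..pi} (\<lambda>\<theta>. cos (real j * \<theta>) *\<^sub>R \<Gamma> \<theta>))"

definition fourier_sin :: "(real \<Rightarrow> real^2) \<Rightarrow> nat \<Rightarrow> real^2" where
  "fourier_sin \<Gamma> j = (1 / pi) *\<^sub>R integral {-pi..pi} (\<lambda>\<theta>. sin (real j * \<theta>) *\<^sub>R \<Gamma> \<theta>)"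

definition grid :: "nat \<Rightarrow> nat \<Rightarrow> real" where
  "grid n l = - (real n + 1) * pi / real n + 2 * pi * real l / real n"

definition riemann_cos :: "nat \<Rightarrow> (real \<Rightarrow> real^2) \<Rightarrow> nat \<Rightarrow> real^2" where
  "riemann_cos n \<Gamma> j =
     (if j = 0 then (1 / real n) *\<^sub>R (\<Sum>l=1..n. \<Gamma> (grid n l))
      else (2 / real n) *\<^sub>R (\<Sum>l=1..n. cos (real j * grid n l) *\<^sub>R \<Gamma> (grid n l)))"

definition riemann_sin :: "nat \<Rightarrow> (real \<Rightarrow> real^2) \<Rightarrow> nat \<Rightarrow> real^2" where
  "riemann_sin n \<Gamma> j =
     (2 / real n) *\<^sub>R (\<Sum>l=1..n. sin (real j * grid n l) *\<^sub>R \<Gamma> (grid n l))"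

definition aliasing :: "nat \<Rightarrow> (real \<Rightarrow> real^2) \<Rightarrow> nat \<Rightarrow> real" where
  "aliasing n \<Gamma> j =
     (if j = 0 then (norm (riemann_cos n \<Gamma> 0 - fourier_cos \<Gamma> 0))\<^sup>2
      else (norm (riemann_cos n \<Gamma> j - fourier_cos \<Gamma> j))\<^sup>2
         + (norm (riemann_sin n \<Gamma> j - fourier_sin \<Gamma> j))\<^sup>2)"

definition noise_cov :: "(nat \<Rightarrow> real) \<Rightarrow> real \<Rightarrow> real" where
  "noise_cov \<sigma> \<theta> = (\<Sum>j. (\<sigma> j)\<^sup>2 * cos (real j * \<theta>))"

definition grid_var :: "(nat \<Rightarrow> real) \<Rightarrow> nat \<Rightarrow> nat \<Rightarrow> real" where
  "grid_var \<sigma> n j =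
     (if j = 0 then (1 / real n) * (\<Sum>l=1..n. noise_cov \<sigma> (grid n l))
      else (2 / real n) * (\<Sum>l=1..n. noise_cov \<sigma> (grid n l) * cos (real j * grid n l)))"

definition weight :: "nat \<Rightarrow> nat \<Rightarrow> nat \<Rightarrow> real \<Rightarrow> real" where
  "weight n J l \<theta> =
     1 / real n + (2 / real n) * (\<Sum>j=1..J. cos (real j * (\<theta> - grid n l)))"

(* The argument x t is the curve observed at time t; only its grid values enter. *)
definition curve_estimator ::
    "nat \<Rightarrow> nat \<Rightarrow> nat \<Rightarrow> (nat \<Rightarrow> real \<Rightarrow> real^2) \<Rightarrow> real \<Rightarrow> real^2" where
  "curve_estimator n J T x \<theta> =
     (1 / (real T + 1)) *\<^sub>R (\<Sum>t=0..T. \<Sum>l=1..n. weight n J l \<theta> *\<^sub>R x t (grid n l))"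

(* Normal law with mean m and standard deviation s; the point mass at m for s = 0. *)
definition gaussian :: "real \<Rightarrow> real \<Rightarrow> real measure" where
  "gaussian m s = (if s = 0 then return borel m else density lborel (normal_density m s))"

(* The product measure is the joint law of the independent Y i with law N(m i, 1). *)
definition noncentral_chi_square :: "nat \<Rightarrow> real \<Rightarrow> real measure \<Rightarrow> bool" where
  "noncentral_chi_square k nc D \<longleftrightarrow>
     (\<exists>m. nc = (\<Sum>i<k. (m i)\<^sup>2) \<and>
          D = distr (\<Pi>\<^sub>M i\<in>{..<k}. gaussian (m i) 1) borel (\<lambda>y. \<Sum>i<k. (y i)\<^sup>2))"

(* Joint independence of the coefficients over all t, j, i makes the processes N t
   independent over t. The variance of A t j i and B t j i is the square of \<sigma> j, which may be 0. *)
locale curve_noise = prob_space M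
  for M :: "'w measure" +
  fixes \<sigma> :: "nat \<Rightarrow> real"
    and A B :: "nat \<Rightarrow> nat \<Rightarrow> 2 \<Rightarrow> 'w \<Rightarrow> real"
    and N :: "nat \<Rightarrow> real \<Rightarrow> 'w \<Rightarrow> real^2"
  assumes coeff_indep:
      "indep_vars (\<lambda>_. borel) (case_sum (\<lambda>(t, j, i). A t j i) (\<lambda>(t, j, i). B t j i)) UNIV"
    and A_law: "\<And>t j i. distr M borel (A t j i) = gaussian 0 (\<sigma> j)"
    and B_law: "\<And>t j i. distr M borel (B t j i) = gaussian 0 (\<sigma> j)"
    and var_decay: "\<exists>\<epsilon>>0. summable (\<lambda>j. real j powr (2 + \<epsilon>) * (\<sigma> j)\<^sup>2)"
    and N_measurable: "\<And>t \<theta>. \<theta> \<in> {-pi..pi} \<Longrightarrow> random_variable borel (N t \<theta>)"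
    and N_series: "\<And>t \<theta> i. \<theta> \<in> {-pi..pi} \<Longrightarrow>
      AE \<omega> in M. (\<lambda>j. A t j i \<omega> * cos (real j * \<theta>) + B t j i \<omega> * sin (real j * \<theta>))
                   sums (N t \<theta> \<omega> $ i)"
    and N_C1: "\<And>t. AE \<omega> in M. C1_within {-pi..pi} (\<lambda>\<theta>. N t \<theta> \<omega>)"

end

theory Submission
  imports Defs
begin

text \<open>
The estimator is a trigonometric polynomial of degree at most \<open>J\<close>. By Parseval's identity its
integrated square error is therefore the tail of the Fourier series of \<open>\<Gamma>\<close> plus the squared errors
of its finitely many coefficients (\<open>integrated_square_error\<close>). Each coefficient error is a
deterministic aliasing error, the difference between a Riemann sum and a Fourier coefficient of
\<open>\<Gamma>\<close>, plus the time average of the same Riemann sums of the noise. The variable \<open>Z\<close> collects these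
squares, grouped by order \<open>j\<close>.

The law of the noise follows from aliasing. On a grid with an odd number \<open>n\<close> of points the
harmonic of order \<open>k\<close> agrees, up to sign, with that of order \<open>j\<close> if \<open>n\<close> divides \<open>k - j\<close> or \<open>k + j\<close>,
and is orthogonal to it otherwise (\<open>alias_coeff_cases\<close>). Hence the noise in a sampled coefficient
of order \<open>j\<close> is the subseries of the random amplitudes over these \<open>k\<close> (\<open>noise_series\<close>). For
different orders below \<open>n / 2\<close> the subseries run over disjoint sets (\<open>dvd_aliases\<close>), so the
coefficients are independent (\<open>indep_vars_noise\<close>). As a series of independent centred Gaussian
variables each of them is Gaussian, with variance \<open>grid_var\<close> (\<open>distr_noise\<close>). After
standardisation, the squared errors of one order are squares of independent Gaussian variables of
variance 1 with shifted means, which is the definition of a noncentral chi-square law.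

For the limit, the standardised average of \<open>T + 1\<close> noise coefficients is a standard normal variable
\<open>G T\<close> for every \<open>T\<close>, and the average itself is a multiple of \<open>G T / sqrt (T + 1)\<close>. The fourth moments
of these quotients are summable, so they tend to zero almost surely
(\<open>AE_gaussian_over_sqrt_tendsto_0\<close>) and only the squared aliasing errors remain in \<open>Z\<close>.
\<close>

section \<open>Fourier coefficients and square errors of trigonometric sums\<close>

definition cos_fourier :: "(real \<Rightarrow> real) \<Rightarrow> nat \<Rightarrow> real" where
  "cos_fourier f j = (if j = 0 then 1 / (2 * pi) else 1 / pi) * integral {-pi..pi} (\<lambda>\<theta>. cos (real j * \<theta>) * f \<theta>)"

definition sin_fourier :: "(real \<Rightarrow> real) \<Rightarrow> nat \<Rightarrow> real" where
  "sin_fourier f j = 1 / pi * integral {-pi..pi} (\<lambda>\<theta>. sin (real j * \<theta>) * f \<theta>)"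

definition trig_sum :: "(nat \<Rightarrow> real) \<Rightarrow> (nat \<Rightarrow> real) \<Rightarrow> nat \<Rightarrow> real \<Rightarrow> real" where
  "trig_sum a b N \<theta> = a 0 + (\<Sum>j=1..N. a j * cos (real j * \<theta>) + b j * sin (real j * \<theta>))"

text \<open>This is the square integral of the trigonometric sum divided by \<open>pi\<close>; the constant harmonic
carries the weight 2 because its square integral is twice that of the others.\<close>
definition trig_energy :: "(nat \<Rightarrow> real) \<Rightarrow> (nat \<Rightarrow> real) \<Rightarrow> nat \<Rightarrow> real" where
  "trig_energy a b N = 2 * (a 0)\<^sup>2 + (\<Sum>j=1..N. (a j)\<^sup>2 + (b j)\<^sup>2)"

lemma continuous_on_trig_sum [continuous_intros]: "continuous_on S (trig_sum a b N)"
  unfolding trig_sum_def by (intro continuous_intros)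

lemma integral_cos_int:
  "integral {-pi..pi} (\<lambda>\<theta>. cos (of_int k * \<theta>)) = (if k = 0 then 2 * pi else 0)"
proof (cases "k = 0")
  case False
  have "((\<lambda>\<theta>. cos (of_int k * \<theta>)) has_integral
      (sin (of_int k * pi) / of_int k - sin (of_int k * (-pi)) / of_int k)) {-pi..pi}"
    by (rule fundamental_theorem_of_calculus)
       (use False in \<open>auto simp flip: has_real_derivative_iff_has_vector_derivative intro!: derivative_eq_intros\<close>)
  then show ?thesis using False by (simp add: integral_unique sin_zero_iff_int2)
qed simp

lemma integral_sin_int: "integral {-pi..pi} (\<lambda>\<theta>. sin (of_int k * \<theta>)) = 0"
proof (cases "k = 0")
  case False
  have "((\<lambda>\<theta>. sin (of_int k * \<theta>)) has_integral
      ((- cos (of_int k * pi) / of_int k) - (- cos (of_int k * (-pi)) / of_int k))) {-pi..pi}"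
    by (rule fundamental_theorem_of_calculus)
       (use False in \<open>auto simp flip: has_real_derivative_iff_has_vector_derivative intro!: derivative_eq_intros\<close>)
  then show ?thesis by (simp add: integral_unique)
qed simp

lemma integral_cos_nat:
  "integral {-pi..pi} (\<lambda>\<theta>. cos ((real j + real k) * \<theta>)) = (if j + k = 0 then 2 * pi else 0)"
  "integral {-pi..pi} (\<lambda>\<theta>. cos ((real j - real k) * \<theta>)) = (if j = k then 2 * pi else 0)"
  "integral {-pi..pi} (\<lambda>\<theta>. sin ((real j + real k) * \<theta>)) = 0"
  "integral {-pi..pi} (\<lambda>\<theta>. sin ((real j - real k) * \<theta>)) = 0"
  using integral_cos_int[of "int j + int k"] integral_cos_int[of "int j - int k"]
    integral_sin_int[of "int j + int k"] integral_sin_int[of "int j - int k"]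
  by auto

lemma trig_integrable:
  "(\<lambda>\<theta>. cos (c * \<theta>)) integrable_on {-pi..pi}" "(\<lambda>\<theta>. sin (c * \<theta>)) integrable_on {-pi..pi}"
  for c :: real
  by (intro integrable_continuous_real continuous_intros)+

lemma integral_cos_cos:
  "integral {-pi..pi} (\<lambda>\<theta>. cos (real j * \<theta>) * cos (real k * \<theta>)) =
     (if j = k then if j = 0 then 2 * pi else pi else 0)"
proof -
  have eq: "(\<lambda>\<theta>. cos (real j * \<theta>) * cos (real k * \<theta>)) =
     (\<lambda>\<theta>. cos ((real j - real k) * \<theta>) / 2 + cos ((real j + real k) * \<theta>) / 2)"
    by (auto simp: cos_times_cos algebra_simps fun_eq_iff add_divide_distrib)
  show ?thesis unfolding eq
    by (subst Henstock_Kurzweil_Integration.integral_add)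
       (simp_all add: integral_cos_nat trig_integrable)
qed

lemma integral_sin_sin:
  "integral {-pi..pi} (\<lambda>\<theta>. sin (real j * \<theta>) * sin (real k * \<theta>)) =
     (if j = k \<and> j \<noteq> 0 then pi else 0)"
proof -
  have eq: "(\<lambda>\<theta>. sin (real j * \<theta>) * sin (real k * \<theta>)) =
     (\<lambda>\<theta>. cos ((real j - real k) * \<theta>) / 2 - cos ((real j + real k) * \<theta>) / 2)"
    by (auto simp: sin_times_sin algebra_simps fun_eq_iff diff_divide_distrib)
  show ?thesis unfolding eq
    by (subst Henstock_Kurzweil_Integration.integral_diff)
       (simp_all add: integral_cos_nat trig_integrable)
qed

lemma integral_sin_cos:
  "integral {-pi..pi} (\<lambda>\<theta>. sin (real j * \<theta>) * cos (real k * \<theta>)) = 0"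
proof -
  have eq: "(\<lambda>\<theta>. sin (real j * \<theta>) * cos (real k * \<theta>)) =
     (\<lambda>\<theta>. sin ((real j + real k) * \<theta>) / 2 + sin ((real j - real k) * \<theta>) / 2)"
    by (simp add: sin_times_cos left_diff_distrib distrib_right fun_eq_iff add_divide_distrib)
  show ?thesis unfolding eq
    by (subst Henstock_Kurzweil_Integration.integral_add)
       (simp_all add: integral_cos_nat trig_integrable)
qed

lemma integral_mult_trig_sum:
  assumes f: "continuous_on {-pi..pi} f"
  shows "integral {-pi..pi} (\<lambda>\<theta>. f \<theta> * trig_sum a b N \<theta>) =
     pi * (2 * a 0 * cos_fourier f 0 + (\<Sum>j=1..N. a j * cos_fourier f j + b j * sin_fourier f j))"
proof -
  have i: "(\<lambda>\<theta>. cos (real j * \<theta>) * f \<theta>) integrable_on {-pi..pi}"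
    "(\<lambda>\<theta>. sin (real j * \<theta>) * f \<theta>) integrable_on {-pi..pi}" "f integrable_on {-pi..pi}" for j
    by (intro integrable_continuous_real continuous_intros f)+
  have eq: "(\<lambda>\<theta>. f \<theta> * trig_sum a b N \<theta>) = (\<lambda>\<theta>. a 0 * f \<theta> +
      (\<Sum>j=1..N. a j * (cos (real j * \<theta>) * f \<theta>) + b j * (sin (real j * \<theta>) * f \<theta>)))"
    by (auto simp: trig_sum_def algebra_simps sum_distrib_left)
  have "integral {-pi..pi} (\<lambda>\<theta>. f \<theta> * trig_sum a b N \<theta>) =
     a 0 * integral {-pi..pi} f + (\<Sum>j=1..N. a j * integral {-pi..pi} (\<lambda>\<theta>. cos (real j * \<theta>) * f \<theta>)
       + b j * integral {-pi..pi} (\<lambda>\<theta>. sin (real j * \<theta>) * f \<theta>))"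
    unfolding eq using i
    by (simp add: Henstock_Kurzweil_Integration.integral_add integral_sum integrable_sum integrable_add
        integrable_on_mult_right)
  also have "\<dots> = pi * (2 * a 0 * cos_fourier f 0) +
      (\<Sum>j=1..N. pi * (a j * cos_fourier f j + b j * sin_fourier f j))"
    by (intro arg_cong2[of _ _ _ _ "(+)"] sum.cong) (auto simp: cos_fourier_def sin_fourier_def field_simps)
  finally show ?thesis by (simp add: sum_distrib_left algebra_simps)
qed

lemma cos_fourier_trig_sum:
  assumes "j \<le> N" shows "cos_fourier (trig_sum a b N) j = a j"
proof -
  have "integral {-pi..pi} (\<lambda>\<theta>. cos (real j * \<theta>) * trig_sum a b N \<theta>) =
     pi * (2 * a 0 * cos_fourier (\<lambda>\<theta>. cos (real j * \<theta>)) 0 + (\<Sum>k=1..N. a k * cos_fourier (\<lambda>\<theta>. cos (real j * \<theta>)) k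
       + b k * sin_fourier (\<lambda>\<theta>. cos (real j * \<theta>)) k))"
    by (rule integral_mult_trig_sum) (intro continuous_intros)
  also have "(\<Sum>k=1..N. a k * cos_fourier (\<lambda>\<theta>. cos (real j * \<theta>)) k
       + b k * sin_fourier (\<lambda>\<theta>. cos (real j * \<theta>)) k) = (\<Sum>k=1..N. if k = j then a k else 0)"
    by (intro sum.cong) (auto simp: cos_fourier_def sin_fourier_def integral_cos_cos integral_sin_cos)
  also have "\<dots> = (if j = 0 then 0 else a j)" using assms by (auto simp: sum.delta')
  also have "cos_fourier (\<lambda>\<theta>. cos (real j * \<theta>)) 0 = (if j = 0 then 1 else 0)"
    using integral_cos_cos[of j 0] by (auto simp: cos_fourier_def)
  finally show ?thesis by (auto simp: cos_fourier_def)
qed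

lemma sin_fourier_trig_sum:
  assumes "1 \<le> j" "j \<le> N" shows "sin_fourier (trig_sum a b N) j = b j"
proof -
  have "integral {-pi..pi} (\<lambda>\<theta>. sin (real j * \<theta>) * trig_sum a b N \<theta>) =
     pi * (2 * a 0 * cos_fourier (\<lambda>\<theta>. sin (real j * \<theta>)) 0 + (\<Sum>k=1..N. a k * cos_fourier (\<lambda>\<theta>. sin (real j * \<theta>)) k
       + b k * sin_fourier (\<lambda>\<theta>. sin (real j * \<theta>)) k))"
    by (rule integral_mult_trig_sum) (intro continuous_intros)
  also have "(\<Sum>k=1..N. a k * cos_fourier (\<lambda>\<theta>. sin (real j * \<theta>)) k
       + b k * sin_fourier (\<lambda>\<theta>. sin (real j * \<theta>)) k) = (\<Sum>k=1..N. if k = j then b k else 0)"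
    using assms
    by (intro sum.cong)
       (auto simp: cos_fourier_def sin_fourier_def integral_sin_sin integral_sin_cos mult.commute[of "cos _"])
  also have "\<dots> = b j" using assms by (auto simp: sum.delta')
  also have "cos_fourier (\<lambda>\<theta>. sin (real j * \<theta>)) 0 = 0"
    using integral_sin_cos[of j 0] by (auto simp: cos_fourier_def)
  finally show ?thesis by (auto simp: sin_fourier_def)
qed

lemma integral_trig_sum_square:
  "integral {-pi..pi} (\<lambda>\<theta>. (trig_sum a b N \<theta>)\<^sup>2) = pi * trig_energy a b N"
  using integral_mult_trig_sum[of "trig_sum a b N" a b N]
  by (simp add: continuous_on_trig_sum power2_eq_square cos_fourier_trig_sum sin_fourier_trig_sum trig_energy_def)

text \<open>Pythagoras: the difference between \<open>f\<close> and its Fourier sum of degree \<open>N\<close> is orthogonal to all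
trigonometric sums of that degree. This one identity serves twice below: it shows that the Fourier
sum is the best approximation, which leads to Parseval's identity, and it splits the error of the
estimator, which is itself a trigonometric sum.\<close>
lemma integral_square_diff_trig_sum:
  assumes f: "continuous_on {-pi..pi} f"
  shows "integral {-pi..pi} (\<lambda>\<theta>. (f \<theta> - trig_sum a b N \<theta>)\<^sup>2) =
     integral {-pi..pi} (\<lambda>\<theta>. (f \<theta>)\<^sup>2) - pi * trig_energy (cos_fourier f) (sin_fourier f) N
     + pi * trig_energy (\<lambda>j. a j - cos_fourier f j) (\<lambda>j. b j - sin_fourier f j) N"
proof -
  note i = integrable_continuous_real continuous_intros f
  have "integral {-pi..pi} (\<lambda>\<theta>. (f \<theta> - trig_sum a b N \<theta>)\<^sup>2) =
      integral {-pi..pi} (\<lambda>\<theta>. (f \<theta>)\<^sup>2 + (trig_sum a b N \<theta>)\<^sup>2 - 2 * (f \<theta> * trig_sum a b N \<theta>))"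
    by (simp add: power2_diff mult.assoc)
  also have "\<dots> = integral {-pi..pi} (\<lambda>\<theta>. (f \<theta>)\<^sup>2 + (trig_sum a b N \<theta>)\<^sup>2)
     - integral {-pi..pi} (\<lambda>\<theta>. 2 * (f \<theta> * trig_sum a b N \<theta>))"
    by (rule Henstock_Kurzweil_Integration.integral_diff) (intro i)+
  also have "integral {-pi..pi} (\<lambda>\<theta>. (f \<theta>)\<^sup>2 + (trig_sum a b N \<theta>)\<^sup>2) =
     integral {-pi..pi} (\<lambda>\<theta>. (f \<theta>)\<^sup>2) + pi * trig_energy a b N"
    unfolding integral_trig_sum_square[symmetric]
    by (rule Henstock_Kurzweil_Integration.integral_add) (intro i)+
  also have "integral {-pi..pi} (\<lambda>\<theta>. 2 * (f \<theta> * trig_sum a b N \<theta>)) =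
     2 * (pi * (2 * a 0 * cos_fourier f 0 + (\<Sum>j=1..N. a j * cos_fourier f j + b j * sin_fourier f j)))"
    by (simp add: integral_mult_trig_sum[OF f])
  finally have 1: "integral {-pi..pi} (\<lambda>\<theta>. (f \<theta> - trig_sum a b N \<theta>)\<^sup>2) =
    integral {-pi..pi} (\<lambda>\<theta>. (f \<theta>)\<^sup>2) + pi * trig_energy a b N - 2 * (pi * (2 * a 0 * cos_fourier f 0 + (\<Sum>j=1..N. a j * cos_fourier f j + b j * sin_fourier f j)))" .
  have 2: "trig_energy (\<lambda>j. a j - cos_fourier f j) (\<lambda>j. b j - sin_fourier f j) N =
     trig_energy a b N + trig_energy (cos_fourier f) (sin_fourier f) N
      - 2 * (2 * a 0 * cos_fourier f 0 + (\<Sum>j=1..N. a j * cos_fourier f j + b j * sin_fourier f j))"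
    by (simp add: trig_energy_def power2_diff sum.distrib sum_subtractf algebra_simps sum_distrib_left)
  show ?thesis unfolding 1 2 by (simp add: algebra_simps)
qed

section \<open>Density of trigonometric polynomials and Parseval's identity\<close>

text \<open>Frequencies are integers so that the product formulas, which produce sums and differences of
frequencies, stay inside the class without a distinction by sign.\<close>
inductive trig_poly :: "(real \<Rightarrow> real) \<Rightarrow> bool" where
  cos: "trig_poly (\<lambda>\<theta>. cos (of_int k * \<theta>))"
| sin: "trig_poly (\<lambda>\<theta>. sin (of_int k * \<theta>))"
| scale: "trig_poly p \<Longrightarrow> trig_poly (\<lambda>\<theta>. c * p \<theta>)"
| add: "trig_poly p \<Longrightarrow> trig_poly q \<Longrightarrow> trig_poly (\<lambda>\<theta>. p \<theta> + q \<theta>)"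

lemma trig_poly_mult_generator:
  assumes "trig_poly p"
  shows "trig_poly (\<lambda>\<theta>. cos (of_int k * \<theta>) * p \<theta>) \<and> trig_poly (\<lambda>\<theta>. sin (of_int k * \<theta>) * p \<theta>)"
  using assms
proof induction
  case (cos l)
  have eq: "(\<lambda>\<theta>::real. cos (of_int k * \<theta>) * cos (of_int l * \<theta>)) =
     (\<lambda>\<theta>. 1/2 * cos (of_int (k - l) * \<theta>) + 1/2 * cos (of_int (k + l) * \<theta>))"
     "(\<lambda>\<theta>::real. sin (of_int k * \<theta>) * cos (of_int l * \<theta>)) =
     (\<lambda>\<theta>. 1/2 * sin (of_int (k + l) * \<theta>) + 1/2 * sin (of_int (k - l) * \<theta>))"
    by (simp_all add: cos_times_cos sin_times_cos left_diff_distrib distrib_right fun_eq_iff add_divide_distrib)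
  show ?case unfolding eq by (intro conjI trig_poly.intros)
next
  case (sin l)
  have eq: "(\<lambda>\<theta>::real. cos (of_int k * \<theta>) * sin (of_int l * \<theta>)) =
     (\<lambda>\<theta>. 1/2 * sin (of_int (k + l) * \<theta>) + (-1/2) * sin (of_int (k - l) * \<theta>))"
     "(\<lambda>\<theta>::real. sin (of_int k * \<theta>) * sin (of_int l * \<theta>)) =
     (\<lambda>\<theta>. 1/2 * cos (of_int (k - l) * \<theta>) + (-1/2) * cos (of_int (k + l) * \<theta>))"
    by (simp_all add: cos_times_sin sin_times_sin left_diff_distrib distrib_right fun_eq_iff diff_divide_distrib)
  show ?case unfolding eq by (intro conjI trig_poly.intros)
next
  case (scale p c)
  then show ?case
    using trig_poly.scale[of "\<lambda>\<theta>. cos (of_int k * \<theta>) * p \<theta>" c] trig_poly.scale[of "\<lambda>\<theta>. sin (of_int k * \<theta>) * p \<theta>" c]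
    by (simp add: mult.left_commute)
next
  case (add p q)
  then show ?case by (auto simp: distrib_left intro: trig_poly.add)
qed

lemma trig_poly_mult:
  assumes "trig_poly p" "trig_poly q"
  shows "trig_poly (\<lambda>\<theta>. p \<theta> * q \<theta>)"
  using assms(1)
proof induction
  case (scale p c)
  then show ?case using trig_poly.scale[of "\<lambda>\<theta>. p \<theta> * q \<theta>" c] by (simp add: mult.assoc)
next
  case (add p r)
  then show ?case using trig_poly.add by (simp add: distrib_right)
qed (use trig_poly_mult_generator[OF assms(2)] in auto)

text \<open>A real-linear functional of \<open>cis \<theta>\<close> is a combination of \<open>cos \<theta>\<close> and \<open>sin \<theta>\<close>, and trigonometric
polynomials form an algebra.\<close>
lemma trig_poly_polynomial_cis:
  fixes g :: "complex \<Rightarrow> real"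
  assumes "real_polynomial_function g"
  shows "trig_poly (\<lambda>\<theta>. g (cis \<theta>))"
  using assms
proof induction
  case (linear g)
  then interpret bounded_linear g .
  have "g (cis \<theta>) = g 1 * cos (of_int 1 * \<theta>) + g \<i> * sin (of_int 1 * \<theta>)" for \<theta>
  proof -
    have "cis \<theta> = cos \<theta> *\<^sub>R 1 + sin \<theta> *\<^sub>R \<i>" by (simp add: complex_eq_iff)
    then show ?thesis by (simp only: add scale) simp
  qed
  then show ?case
    using trig_poly.add[OF trig_poly.scale[OF trig_poly.cos] trig_poly.scale[OF trig_poly.sin]] by presburger
next
  case (const c)
  show ?case using trig_poly.scale[OF trig_poly.cos[of 0], of c] by simp
qed (auto intro: trig_poly.add trig_poly_mult)

text \<open>Padding with zeros turns finitely many coefficients into sequences that represent \<open>p\<close> for every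
large degree, so that coefficients of sums can be added termwise.\<close>
lemma trig_poly_imp_trig_sum:
  assumes "trig_poly p"
  shows "\<exists>a b. \<forall>\<^sub>F N in sequentially. p = trig_sum a b N"
  using assms
proof induction
  case (cos k)
  let ?a = "\<lambda>j. if j = nat \<bar>k\<bar> then 1 else 0 :: real"
  have "(\<lambda>\<theta>. cos (of_int k * \<theta>)) = trig_sum ?a (\<lambda>_. 0) N" if "N \<ge> nat \<bar>k\<bar>" for N
  proof
    fix \<theta> :: real
    have "trig_sum ?a (\<lambda>_. 0) N \<theta> = ?a 0 + (\<Sum>j=1..N. if j = nat \<bar>k\<bar> then cos (real j * \<theta>) else 0)"
      unfolding trig_sum_def by (intro arg_cong2[of _ _ _ _ "(+)"] sum.cong) auto
    also have "\<dots> = cos (of_int \<bar>k\<bar> * \<theta>)"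
      using that by (auto simp: sum.delta')
    also have "\<dots> = cos (of_int k * \<theta>)" by (cases "k \<ge> 0") auto
    finally show "cos (of_int k * \<theta>) = trig_sum ?a (\<lambda>_. 0) N \<theta>" by simp
  qed
  then show ?case by (intro exI eventually_sequentiallyI[of "nat \<bar>k\<bar>"])
next
  case (sin k)
  let ?b = "\<lambda>j. if j = nat \<bar>k\<bar> then of_int (sgn k) else 0 :: real"
  have "(\<lambda>\<theta>. sin (of_int k * \<theta>)) = trig_sum (\<lambda>_. 0) ?b N" if "N \<ge> nat \<bar>k\<bar>" for N
  proof
    fix \<theta> :: real
    have "trig_sum (\<lambda>_. 0) ?b N \<theta> = (\<Sum>j=1..N. if j = nat \<bar>k\<bar> then of_int (sgn k) * sin (real j * \<theta>) else 0)"
      unfolding trig_sum_def by (simp only: add_0) (intro sum.cong; auto)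
    also have "\<dots> = of_int (sgn k) * sin (of_int \<bar>k\<bar> * \<theta>)"
      using that by (cases "k = 0") (auto simp: sum.delta')
    also have "\<dots> = sin (of_int k * \<theta>)" by (cases "k \<ge> 0") (auto simp: sgn_if)
    finally show "sin (of_int k * \<theta>) = trig_sum (\<lambda>_. 0) ?b N \<theta>" by simp
  qed
  then show ?case by (intro exI eventually_sequentiallyI[of "nat \<bar>k\<bar>"])
next
  case (scale p c)
  then obtain a b where "\<forall>\<^sub>F N in sequentially. p = trig_sum a b N" by blast
  then have "\<forall>\<^sub>F N in sequentially. (\<lambda>\<theta>. c * p \<theta>) = trig_sum (\<lambda>j. c * a j) (\<lambda>j. c * b j) N"
    by eventually_elim (auto simp: trig_sum_def sum_distrib_left algebra_simps)
  then show ?case by blast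
next
  case (add p q)
  then obtain a b a' b' where "\<forall>\<^sub>F N in sequentially. p = trig_sum a b N"
    "\<forall>\<^sub>F N in sequentially. q = trig_sum a' b' N" by blast
  then have "\<forall>\<^sub>F N in sequentially. (\<lambda>\<theta>. p \<theta> + q \<theta>) = trig_sum (\<lambda>j. a j + a' j) (\<lambda>j. b j + b' j) N"
    by eventually_elim (auto simp: trig_sum_def sum.distrib algebra_simps)
  then show ?case by blast
qed

lemma periodic_Arg_cis:
  assumes "f (-pi) = f pi" and "\<theta> \<in> {-pi..pi}"
  shows "f (Arg (cis \<theta>)) = f \<theta>"
proof (cases "\<theta> = -pi")
  case True
  then show ?thesis using assms Arg_cis[of pi] by (simp add: cis_pi flip: cis_cnj)
qed (use assms in \<open>simp add: Arg_cis\<close>)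

text \<open>\<open>Arg\<close> jumps at \<open>-1\<close>, but the two one-sided limits are the end points of the interval, where \<open>f\<close>
takes equal values. In terms of sets: the preimage of a closed set is the image under \<open>cis\<close> of a
compact subset of the interval, hence closed.\<close>
lemma continuous_on_circle_Arg:
  fixes f :: "real \<Rightarrow> 'a::topological_space"
  assumes f: "continuous_on {-pi..pi} f" and per: "f (-pi) = f pi"
  shows "continuous_on (sphere 0 1) (\<lambda>z. f (Arg z))"
proof -
  show ?thesis
    unfolding continuous_on_closed_vimage[OF closed_sphere]
  proof safe
    fix C :: "'a set" assume C: "closed C"
    have "(\<lambda>z. f (Arg z)) -` C \<inter> sphere 0 1 = cis ` (f -` C \<inter> {-pi..pi})"
    proof safe
      fix z :: complex assume z: "f (Arg z) \<in> C" "z \<in> sphere 0 1"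
      then have "z = cis (Arg z)" using cis_Arg[of z] by (cases "z = 0") (auto simp: sgn_eq)
      moreover have "Arg z \<in> {-pi..pi}" using Arg_bounded[of z] by auto
      ultimately show "z \<in> cis ` (f -` C \<inter> {-pi..pi})" using z by blast
    qed (auto simp: periodic_Arg_cis[of f, OF per])
    moreover have "closed (f -` C \<inter> {-pi..pi})"
      using C f by (simp add: continuous_on_closed_vimage)
    then have "compact (f -` C \<inter> {-pi..pi})"
      using closed_Int_compact[of "f -` C \<inter> {-pi..pi}" "{-pi..pi}"] by (simp add: Int_assoc)
    ultimately show "closed ((\<lambda>z. f (Arg z)) -` C \<inter> sphere 0 1)"
      by (simp add: compact_imp_closed compact_continuous_image continuous_on_cis)
  qed
qed

text \<open>Stone--Weierstrass on the unit circle, transported to the interval along \<open>cis\<close>.\<close>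
lemma trig_poly_dense:
  assumes f: "continuous_on {-pi..pi} f" and per: "f (-pi) = f pi" and "e > 0"
  obtains p where "trig_poly p" "\<And>\<theta>. \<theta> \<in> {-pi..pi} \<Longrightarrow> \<bar>f \<theta> - p \<theta>\<bar> < e"
proof -
  obtain g where g: "real_polynomial_function g" "\<And>z::complex. z \<in> sphere 0 1 \<Longrightarrow> \<bar>f (Arg z) - g z\<bar> < e"
    using Stone_Weierstrass_real_polynomial_function[OF compact_sphere continuous_on_circle_Arg[OF f per] \<open>e > 0\<close>]
    by blast
  have "\<bar>f \<theta> - g (cis \<theta>)\<bar> < e" if "\<theta> \<in> {-pi..pi}" for \<theta>
  proof -
    have "f (Arg (cis \<theta>)) = f \<theta>" by (rule periodic_Arg_cis[of f, OF per that])
    then show ?thesis using g(2)[of "cis \<theta>"] by simp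
  qed
  then show thesis using that trig_poly_polynomial_cis[OF g(1)] by blast
qed

text \<open>By \<open>integral_square_diff_trig_sum\<close> the defect in Bessel's inequality is the least square error
of trigonometric sums of degree \<open>N\<close>, and density makes it small.\<close>
theorem parseval:
  assumes f: "continuous_on {-pi..pi} f" and per: "f (-pi) = f pi"
  shows "(\<lambda>N. pi * trig_energy (cos_fourier f) (sin_fourier f) N) \<longlonglongrightarrow> integral {-pi..pi} (\<lambda>\<theta>. (f \<theta>)\<^sup>2)"
proof -
  define D where "D N = integral {-pi..pi} (\<lambda>\<theta>. (f \<theta>)\<^sup>2) - pi * trig_energy (cos_fourier f) (sin_fourier f) N" for N
  have D_eq: "D N = integral {-pi..pi} (\<lambda>\<theta>. (f \<theta> - trig_sum (cos_fourier f) (sin_fourier f) N \<theta>)\<^sup>2)" for N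
    unfolding integral_square_diff_trig_sum[OF f] D_def by (simp add: trig_energy_def)
  have D_nonneg: "0 \<le> D N" for N
    unfolding D_eq by (intro integral_nonneg integrable_continuous_real continuous_intros f) auto
  have D_le: "D N \<le> integral {-pi..pi} (\<lambda>\<theta>. (f \<theta> - trig_sum a b N \<theta>)\<^sup>2)" for a b N
    unfolding integral_square_diff_trig_sum[OF f] D_def
    by (simp add: trig_energy_def sum_nonneg)
  have "D \<longlonglongrightarrow> 0"
  proof (rule LIMSEQ_I)
    fix r :: real assume r: "0 < r"
    \<comment> \<open>a uniform error e on an interval of length 2 pi gives the square error r / 2\<close>
    define e where "e = sqrt (r / (4 * pi))"
    have e: "e > 0" "e\<^sup>2 = r / (4 * pi)" using r by (auto simp: e_def)
    obtain p where p: "trig_poly p" "\<And>\<theta>. \<theta> \<in> {-pi..pi} \<Longrightarrow> \<bar>f \<theta> - p \<theta>\<bar> < e"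
      using trig_poly_dense[OF f per e(1)] by blast
    obtain a b N0 where ab: "\<And>N. N \<ge> N0 \<Longrightarrow> p = trig_sum a b N"
      using trig_poly_imp_trig_sum[OF p(1)] unfolding eventually_sequentially by blast
    have "norm (D N - 0) < r" if "N \<ge> N0" for N
    proof -
      have "D N \<le> integral {-pi..pi} (\<lambda>\<theta>. (f \<theta> - trig_sum a b N \<theta>)\<^sup>2)" by (rule D_le)
      also have "\<dots> \<le> integral {-pi..pi} (\<lambda>\<theta>. e\<^sup>2)"
      proof (rule integral_le)
        fix \<theta> assume "\<theta> \<in> {-pi..pi}"
        then show "(f \<theta> - trig_sum a b N \<theta>)\<^sup>2 \<le> e\<^sup>2"
          using p(2)[of \<theta>] ab[OF that] by (simp add: abs_le_square_iff[symmetric])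
      qed (intro integrable_continuous_real continuous_intros f)+
      also have "\<dots> = r / 2" by (simp add: e)
      also have "\<dots> < r" using r by simp
      finally show ?thesis using D_nonneg[of N] by simp
    qed
    then show "\<exists>N0. \<forall>N\<ge>N0. norm (D N - 0) < r" by blast
  qed
  from tendsto_diff[OF tendsto_const this, of "integral {-pi..pi} (\<lambda>\<theta>. (f \<theta>)\<^sup>2)"]
  show ?thesis by (simp add: D_def)
qed

text \<open>The remainder of the energy series is what a sum of degree \<open>J\<close> cannot reduce; the rest of its square
error comes from wrong coefficients.\<close>
theorem integral_square_diff_trig_sum_tail:
  assumes f: "continuous_on {-pi..pi} f" and per: "f (-pi) = f pi"
  shows "(\<lambda>j. (cos_fourier f (J + 1 + j))\<^sup>2 + (sin_fourier f (J + 1 + j))\<^sup>2) sums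
     (1 / pi * integral {-pi..pi} (\<lambda>\<theta>. (f \<theta> - trig_sum a b J \<theta>)\<^sup>2)
       - trig_energy (\<lambda>j. a j - cos_fourier f j) (\<lambda>j. b j - sin_fourier f j) J)"
proof -
  let ?E = "trig_energy (cos_fourier f) (sin_fourier f)" and ?I = "integral {-pi..pi} (\<lambda>\<theta>. (f \<theta>)\<^sup>2)"
  let ?t = "\<lambda>j. (cos_fourier f j)\<^sup>2 + (sin_fourier f j)\<^sup>2"
  have eq: "(\<Sum>j<m. ?t (J + 1 + j)) = ?E (m + J) - ?E J" for m
    by (induction m) (auto simp: trig_energy_def algebra_simps)
  have "(\<lambda>N. ?E N) \<longlonglongrightarrow> ?I / pi"
    using tendsto_divide[OF parseval[OF f per] tendsto_const[of pi]] by simp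
  then have "(\<lambda>m. ?E (m + J) - ?E J) \<longlonglongrightarrow> ?I / pi - ?E J"
    by (intro tendsto_intros) (rule LIMSEQ_ignore_initial_segment)
  also have "?I / pi - ?E J = 1 / pi * integral {-pi..pi} (\<lambda>\<theta>. (f \<theta> - trig_sum a b J \<theta>)\<^sup>2)
       - trig_energy (\<lambda>j. a j - cos_fourier f j) (\<lambda>j. b j - sin_fourier f j) J"
    unfolding integral_square_diff_trig_sum[OF f] by (simp add: field_simps)
  finally show ?thesis unfolding sums_def eq .
qed

section \<open>Gaussian laws\<close>

lemma normal_density_minus: "normal_density m (- s) = normal_density m s"
  by (simp add: normal_density_def fun_eq_iff)

text \<open>An affine image of the standard normal law covers point masses and densities, and both signs of \<open>s\<close>,
by one formula.\<close>
lemma gaussian_eq_affine: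
  "gaussian m s = distr std_normal_distribution borel (\<lambda>x. m + s * x)"
proof (cases "s = 0")
  case True
  interpret prob_space std_normal_distribution by (rule prob_space_normal_density) simp
  show ?thesis using True by (simp add: gaussian_def distr_const)
next
  case False
  interpret prob_space std_normal_distribution by (rule prob_space_normal_density) simp
  have "distributed std_normal_distribution lborel (\<lambda>x. x) std_normal_density"
    by (auto simp: distributed_def distr_id2)
  from normal_density_affine[OF this zero_less_one False, of m]
  have "distr std_normal_distribution lborel (\<lambda>x. m + s * x) = density lborel (normal_density m \<bar>s\<bar>)"
    by (simp add: distributed_def)
  moreover have "normal_density m \<bar>s\<bar> = normal_density m s"
    by (simp add: abs_if normal_density_minus)
  moreover have "distr std_normal_distribution lborel (\<lambda>x. m + s * x) =
      distr std_normal_distribution borel (\<lambda>x. m + s * x)"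
    by (rule distr_cong) auto
  ultimately show ?thesis using False by (simp add: gaussian_def)
qed

lemma real_distribution_gaussian: "real_distribution (gaussian m s)"
proof -
  interpret prob_space std_normal_distribution by (rule prob_space_normal_density) simp
  show ?thesis unfolding gaussian_eq_affine by (rule real_distribution_distr) simp
qed

lemma (in prob_space) char_distr_affine:
  fixes X :: "'a \<Rightarrow> real"
  assumes [measurable]: "random_variable borel X"
  shows "char (distr M borel (\<lambda>\<omega>. b + a * X \<omega>)) t = iexp (t * b) * char (distr M borel X) (t * a)"
  by (simp add: char_def integral_distr exp_add[symmetric] distrib_left mult.assoc flip: integral_mult_right_zero)

lemma char_gaussian: "char (gaussian m s) t = iexp (t * m) * exp (- (s\<^sup>2 * t\<^sup>2) / 2)"
proof -
  interpret prob_space std_normal_distribution by (rule prob_space_normal_density) simp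
  have "distr std_normal_distribution borel (\<lambda>x. x) = std_normal_distribution"
    by (simp add: distr_id2)
  then show ?thesis
    unfolding gaussian_eq_affine
    by (subst char_distr_affine) (simp_all add: char_std_normal_distribution power_mult_distrib mult.commute)
qed

lemma (in prob_space) distr_eq_gaussianI:
  fixes X :: "'a \<Rightarrow> real"
  assumes "random_variable borel X"
    and "\<And>t. char (distr M borel X) t = iexp (t * m) * exp (- (s\<^sup>2 * t\<^sup>2) / 2)"
  shows "distr M borel X = gaussian m s"
  by (intro Levy_uniqueness real_distribution_gaussian real_distribution_distr assms)
     (simp add: fun_eq_iff assms char_gaussian)

lemma (in prob_space) gaussian_affine:
  assumes X: "random_variable borel X" "distr M borel X = gaussian m s"
  shows "distr M borel (\<lambda>\<omega>. b + a * X \<omega>) = gaussian (b + a * m) (a * s)"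
proof (rule distr_eq_gaussianI)
  fix t
  show "char (distr M borel (\<lambda>\<omega>. b + a * X \<omega>)) t =
      iexp (t * (b + a * m)) * exp (- ((a * s)\<^sup>2 * t\<^sup>2) / 2)"
    unfolding char_distr_affine[OF X(1)] X(2) char_gaussian
    by (simp add: exp_add[symmetric] algebra_simps power_mult_distrib)
qed (use X in measurable)

lemma (in prob_space) gaussian_sum:
  assumes "finite I" and ind: "indep_vars (\<lambda>_. borel) X I"
    and X: "\<And>i. i \<in> I \<Longrightarrow> distr M borel (X i) = gaussian (m i) (s i)"
  shows "distr M borel (\<lambda>\<omega>. \<Sum>i\<in>I. X i \<omega>) = gaussian (\<Sum>i\<in>I. m i) (sqrt (\<Sum>i\<in>I. (s i)\<^sup>2))"
proof (rule distr_eq_gaussianI)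
  show "random_variable borel (\<lambda>\<omega>. \<Sum>i\<in>I. X i \<omega>)"
    using ind by (intro borel_measurable_sum) (simp add: indep_vars_def)
  fix t
  have "char (distr M borel (\<lambda>\<omega>. \<Sum>i\<in>I. X i \<omega>)) t =
      (\<Prod>i\<in>I. iexp (t * m i) * exp (- ((s i)\<^sup>2 * t\<^sup>2) / 2))"
    unfolding char_distr_sum[OF ind] by (intro prod.cong) (auto simp: X char_gaussian)
  also have "\<dots> = iexp (t * (\<Sum>i\<in>I. m i)) * exp (- ((\<Sum>i\<in>I. (s i)\<^sup>2) * t\<^sup>2) / 2)"
    using \<open>finite I\<close>
    by (simp add: prod.distrib exp_sum[symmetric] sum_distrib_left sum_distrib_right sum_divide_distrib sum_negf
         flip: of_real_prod)
  finally show "char (distr M borel (\<lambda>\<omega>. \<Sum>i\<in>I. X i \<omega>)) t =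
      iexp (t * (\<Sum>i\<in>I. m i)) * exp (- ((sqrt (\<Sum>i\<in>I. (s i)\<^sup>2))\<^sup>2 * t\<^sup>2) / 2)"
    by (simp add: sum_nonneg)
qed

text \<open>Bounded convergence passes almost sure limits to characteristic functions, and Levy's uniqueness
theorem identifies the limit law.\<close>
lemma (in prob_space) gaussian_AE_limit:
  fixes X :: "nat \<Rightarrow> 'a \<Rightarrow> real"
  assumes X [measurable]: "\<And>n. random_variable borel (X n)"
    and Y [measurable]: "random_variable borel Y"
    and lim: "AE \<omega> in M. (\<lambda>n. X n \<omega>) \<longlonglongrightarrow> Y \<omega>"
    and law: "\<And>n. distr M borel (X n) = gaussian 0 (s n)"
    and v: "(\<lambda>n. (s n)\<^sup>2) \<longlonglongrightarrow> v"
  shows "distr M borel Y = gaussian 0 (sqrt v)"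
proof (rule distr_eq_gaussianI)
  fix t
  have char_eq: "char (distr M borel Z) t = (LINT \<omega>|M. iexp (t * Z \<omega>))"
    if [measurable]: "random_variable borel Z" for Z
    by (simp add: char_def integral_distr)
  have "(\<lambda>n. char (distr M borel (X n)) t) \<longlonglongrightarrow> char (distr M borel Y) t"
    unfolding char_eq[OF X] char_eq[OF Y]
  proof (rule integral_dominated_convergence[where w = "\<lambda>_. 1"])
    show "AE \<omega> in M. (\<lambda>n. iexp (t * X n \<omega>)) \<longlonglongrightarrow> iexp (t * Y \<omega>)"
      using lim by eventually_elim (intro tendsto_intros)
  qed auto
  moreover have "(\<lambda>n. char (distr M borel (X n)) t) \<longlonglongrightarrow> complex_of_real (exp (- (v * t\<^sup>2) / 2))"
    unfolding law char_gaussian by (simp, intro tendsto_intros v) simp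
  moreover have "v \<ge> 0" using v by (rule LIMSEQ_le_const) auto
  ultimately show "char (distr M borel Y) t = iexp (t * 0) * exp (- ((sqrt v)\<^sup>2 * t\<^sup>2) / 2)"
    using LIMSEQ_unique by fastforce
qed fact

lemma (in prob_space) gaussian_series:
  fixes X :: "nat \<Rightarrow> 'a \<Rightarrow> real"
  assumes ind: "indep_vars (\<lambda>_. borel) X UNIV"
    and law: "\<And>k. distr M borel (X k) = gaussian 0 (s k)"
    and Y: "random_variable borel Y" "AE \<omega> in M. (\<lambda>k. d k * X k \<omega>) sums Y \<omega>"
    and v: "(\<lambda>k. (d k * s k)\<^sup>2) sums v"
  shows "distr M borel Y = gaussian 0 (sqrt v)"
proof (rule gaussian_AE_limit)
  have X [measurable]: "random_variable borel (X k)" for k using ind by (simp add: indep_vars_def)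
  show "random_variable borel (\<lambda>\<omega>. \<Sum>k<n. d k * X k \<omega>)" for n by measurable
  show "AE \<omega> in M. (\<lambda>n. \<Sum>k<n. d k * X k \<omega>) \<longlonglongrightarrow> Y \<omega>" using Y(2) by (simp add: sums_def)
  show "distr M borel (\<lambda>\<omega>. \<Sum>k<n. d k * X k \<omega>) = gaussian 0 (sqrt (\<Sum>k<n. (d k * s k)\<^sup>2))" for n
  proof -
    have "distr M borel (\<lambda>\<omega>. d k * X k \<omega>) = gaussian 0 (d k * s k)" for k
      using gaussian_affine[OF X law, of 0 "d k" k] by simp
    moreover have "indep_vars (\<lambda>_. borel) (\<lambda>k \<omega>. d k * X k \<omega>) {..<n}"
      by (rule indep_vars_compose2[OF indep_vars_subset[OF ind]]) auto
    ultimately show ?thesis using gaussian_sum[of "{..<n}" "\<lambda>k \<omega>. d k * X k \<omega>" "\<lambda>_. 0"] by simp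
  qed
  show "(\<lambda>n. (sqrt (\<Sum>k<n. (d k * s k)\<^sup>2))\<^sup>2) \<longlonglongrightarrow> v" using v by (simp add: sums_def sum_nonneg)
qed fact

lemma nn_integral_gaussian_pow4: "(\<integral>\<^sup>+x. ennreal (x ^ 4) \<partial>gaussian 0 1) = 3"
proof -
  have "has_bochner_integral lborel (\<lambda>x. std_normal_density x * x ^ 4) 3"
    using std_normal_moment_even[of 2] by (simp add: fact_numeral)
  then have "(\<integral>\<^sup>+x. ennreal (std_normal_density x * x ^ 4) \<partial>lborel) = ennreal 3"
    by (subst nn_integral_eq_integral) (auto simp: has_bochner_integral_iff normal_density_nonneg)
  then show ?thesis
    by (simp add: gaussian_def nn_integral_density ennreal_mult'' normal_density_nonneg)
qed

text \<open>The fourth powers have expectations \<open>3 / (n + 1)\<^sup>2\<close>, which are summable. So their sum is integrable,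
hence almost surely finite, and its terms tend to zero. Second moments would only give the divergent
harmonic series.\<close>
lemma (in prob_space) AE_gaussian_over_sqrt_tendsto_0:
  fixes G :: "nat \<Rightarrow> 'a \<Rightarrow> real"
  assumes G [measurable]: "\<And>n. random_variable borel (G n)"
    and law: "\<And>n. distr M borel (G n) = gaussian 0 1"
  shows "AE \<omega> in M. (\<lambda>n. G n \<omega> / sqrt (real n + 1)) \<longlonglongrightarrow> 0"
proof -
  have m4: "(\<integral>\<^sup>+\<omega>. ennreal ((G n \<omega>) ^ 4) \<partial>M) = 3" for n
    using nn_integral_gaussian_pow4 unfolding law[of n, symmetric] by (simp add: nn_integral_distr)
  have pow: "(G n \<omega> / sqrt (real n + 1)) ^ 4 = 1 / (real n + 1)\<^sup>2 * G n \<omega> ^ 4" for n \<omega>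
  proof -
    have "sqrt (real n + 1) ^ 4 = (real n + 1)\<^sup>2"
      using power_mult[of "sqrt (real n + 1)" 2 2] by simp
    then show ?thesis by (simp add: power_divide)
  qed
  have "(\<integral>\<^sup>+\<omega>. (\<Sum>n. ennreal ((G n \<omega> / sqrt (real n + 1)) ^ 4)) \<partial>M) =
      (\<Sum>n. \<integral>\<^sup>+\<omega>. ennreal ((G n \<omega> / sqrt (real n + 1)) ^ 4) \<partial>M)"
    by (rule nn_integral_suminf) measurable
  also have "(\<lambda>n. \<integral>\<^sup>+\<omega>. ennreal ((G n \<omega> / sqrt (real n + 1)) ^ 4) \<partial>M) =
      (\<lambda>n. ennreal (3 / (real n + 1)\<^sup>2))"
  proof
    fix n
    have "(\<integral>\<^sup>+\<omega>. ennreal ((G n \<omega> / sqrt (real n + 1)) ^ 4) \<partial>M) =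
        (\<integral>\<^sup>+\<omega>. ennreal (1 / (real n + 1)\<^sup>2) * ennreal (G n \<omega> ^ 4) \<partial>M)"
      unfolding pow by (intro nn_integral_cong ennreal_mult) auto
    also have "\<dots> = ennreal (1 / (real n + 1)\<^sup>2) * ennreal 3"
      by (subst nn_integral_cmult) (auto simp: m4)
    also have "\<dots> = ennreal (3 / (real n + 1)\<^sup>2)"
      by (subst ennreal_mult[symmetric]) auto
    finally show "(\<integral>\<^sup>+\<omega>. ennreal ((G n \<omega> / sqrt (real n + 1)) ^ 4) \<partial>M) = ennreal (3 / (real n + 1)\<^sup>2)" .
  qed
  also have "(\<Sum>n. ennreal (3 / (real n + 1)\<^sup>2)) \<noteq> \<infinity>"
  proof -
    have "summable (\<lambda>n. inverse (real (Suc n) ^ 2))"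
      using inverse_power_summable[of 2, where 'a = real] by (subst summable_Suc_iff) simp
    then have "summable (\<lambda>n. 3 * inverse (real (Suc n) ^ 2))" by (rule summable_mult)
    then have "summable (\<lambda>n. 3 / (real n + 1)\<^sup>2)" by (simp add: divide_inverse add.commute)
    then show ?thesis by (simp add: suminf_ennreal2 ennreal_suminf_neq_top)
  qed
  finally have "AE \<omega> in M. (\<Sum>n. ennreal ((G n \<omega> / sqrt (real n + 1)) ^ 4)) \<noteq> \<infinity>"
    by (intro nn_integral_PInf_AE) auto
  then show ?thesis
  proof eventually_elim
    case (elim \<omega>)
    let ?x = "\<lambda>n. G n \<omega> / sqrt (real n + 1)"
    have "summable (\<lambda>n. ?x n ^ 4)"
      using elim by (intro summable_suminf_not_top) auto
    then have "(\<lambda>n. sqrt (sqrt (?x n ^ 4))) \<longlonglongrightarrow> sqrt (sqrt 0)"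
      by (intro tendsto_intros summable_LIMSEQ_zero)
    moreover have "sqrt (sqrt (x ^ 4)) = \<bar>x\<bar>" for x :: real
    proof -
      have "sqrt (sqrt ((x\<^sup>2)\<^sup>2)) = \<bar>x\<bar>" by (simp only: real_sqrt_abs abs_power2)
      then show ?thesis by simp
    qed
    ultimately have "(\<lambda>n. \<bar>?x n\<bar>) \<longlonglongrightarrow> 0" by simp
    then show ?case by (rule tendsto_rabs_zero_cancel)
  qed
qed

section \<open>Independence of functions of disjoint blocks\<close>

text \<open>Independence is a property of the joint law, which does not see null sets; countability of \<open>I\<close>
keeps the union of the exceptional sets null.\<close>
lemma (in prob_space) indep_vars_AE_cong:
  fixes X Y :: "'i \<Rightarrow> 'a \<Rightarrow> 'b"
  assumes ind: "indep_vars N X I" and "countable I"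
    and Y [measurable]: "\<And>i. i \<in> I \<Longrightarrow> random_variable (N i) (Y i)"
    and eq: "\<And>i. i \<in> I \<Longrightarrow> AE \<omega> in M. X i \<omega> = Y i \<omega>"
  shows "indep_vars N Y I"
proof (cases "I = {}")
  case False
  have X [measurable]: "\<And>i. i \<in> I \<Longrightarrow> random_variable (N i) (X i)" using ind by (simp add: indep_vars_def)
  have "AE \<omega> in M. \<forall>i\<in>I. X i \<omega> = Y i \<omega>" using eq \<open>countable I\<close> by (simp add: AE_ball_countable)
  then have "distr M (\<Pi>\<^sub>M i\<in>I. N i) (\<lambda>x. \<lambda>i\<in>I. Y i x) = distr M (\<Pi>\<^sub>M i\<in>I. N i) (\<lambda>x. \<lambda>i\<in>I. X i x)"
    by (intro distr_cong_AE) (auto elim!: eventually_mono intro!: restrict_ext measurable_restrict)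
  also have "\<dots> = (\<Pi>\<^sub>M i\<in>I. distr M (N i) (X i))"
    using ind indep_vars_iff_distr_eq_PiM'[OF False, of X N] X by simp
  also have "\<dots> = (\<Pi>\<^sub>M i\<in>I. distr M (N i) (Y i))"
    using eq by (intro PiM_cong distr_cong_AE) auto
  finally show ?thesis using indep_vars_iff_distr_eq_PiM'[OF False, of Y N] Y by simp
qed (simp add: indep_vars_def indep_sets_def)

text \<open>Functions of disjoint blocks of independent variables are independent. The functions \<open>F l\<close> are named
separately so that their measurability can be checked on the product space.\<close>
lemma (in prob_space) indep_vars_blockwise:
  fixes X :: "'i \<Rightarrow> 'a \<Rightarrow> real" and Y :: "'l \<Rightarrow> 'a \<Rightarrow> real"
  assumes ind: "indep_vars (\<lambda>_. borel) X I"
    and K: "\<And>l. l \<in> L \<Longrightarrow> K l \<subseteq> I" "disjoint_family_on K L"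
    and F: "\<And>l. l \<in> L \<Longrightarrow> F l \<in> borel_measurable (\<Pi>\<^sub>M i\<in>K l. borel)"
    and Y: "\<And>l \<omega>. l \<in> L \<Longrightarrow> Y l \<omega> = F l (\<lambda>i\<in>K l. X i \<omega>)"
  shows "indep_vars (\<lambda>_. borel) Y L"
proof -
  have "indep_vars (\<lambda>_. borel) (\<lambda>l \<omega>. F l (\<lambda>i\<in>K l. X i \<omega>)) L"
    by (rule indep_vars_compose2[OF indep_vars_restrict[OF ind K]]) (use F in auto)
  then show ?thesis by (subst indep_vars_cong[OF refl _ refl]) (auto simp: Y fun_eq_iff)
qed

lemma (in prob_space) indep_vars_reindex_inj:
  fixes X :: "'i \<Rightarrow> 'a \<Rightarrow> real"
  assumes "indep_vars (\<lambda>_. borel) X I" and "inj_on f L" "f ` L \<subseteq> I"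
  shows "indep_vars (\<lambda>_. borel) (\<lambda>l. X (f l)) L"
  by (rule indep_vars_blockwise[OF assms(1), where K = "\<lambda>l. {f l}" and F = "\<lambda>l x. x (f l)"])
     (use assms(2,3) in \<open>auto simp: disjoint_family_on_def inj_on_def\<close>)

lemma (in prob_space) noncentral_chi_square_sum_squares:
  assumes ind: "indep_vars (\<lambda>_. borel) Y {..<k}" and "k > 0"
    and law: "\<And>q. q < k \<Longrightarrow> distr M borel (Y q) = gaussian (m q) 1"
  shows "noncentral_chi_square k (\<Sum>q<k. (m q)\<^sup>2) (distr M borel (\<lambda>\<omega>. \<Sum>q<k. (Y q \<omega>)\<^sup>2))"
proof -
  have Y [measurable]: "random_variable borel (Y q)" if "q < k" for q
    using ind that by (simp add: indep_vars_def)
  have "distr (\<Pi>\<^sub>M q\<in>{..<k}. gaussian (m q) 1) borel (\<lambda>y. \<Sum>q<k. (y q)\<^sup>2) =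
      distr (\<Pi>\<^sub>M q\<in>{..<k}. distr M borel (Y q)) borel (\<lambda>y. \<Sum>q<k. (y q)\<^sup>2)"
    by (intro distr_cong PiM_cong) (auto simp: law)
  also have "\<dots> = distr (distr M (\<Pi>\<^sub>M q\<in>{..<k}. borel) (\<lambda>\<omega>. \<lambda>q\<in>{..<k}. Y q \<omega>)) borel (\<lambda>y. \<Sum>q<k. (y q)\<^sup>2)"
    using ind \<open>k > 0\<close> by (subst (asm) indep_vars_iff_distr_eq_PiM') (auto simp: Y)
  also have "\<dots> = distr M borel (\<lambda>\<omega>. \<Sum>q<k. (Y q \<omega>)\<^sup>2)"
    by (subst distr_distr) (auto intro!: measurable_restrict distr_cong simp: Y)
  finally show ?thesis unfolding noncentral_chi_square_def by metis
qed

section \<open>Aliasing on the grid\<close>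

text \<open>For odd \<open>n\<close> the grid points are the integer multiples \<open>2 * pi * (l - m) / n\<close> with \<open>2 * m = n + 1\<close>,
so the sum is, up to a factor of modulus 1, a full period of powers of an \<open>n\<close>-th root of unity.\<close>
lemma sum_cis_grid:
  assumes "odd n"
  shows "(\<Sum>l=1..n. cis (of_int k * grid n l)) = (if int n dvd k then of_nat n else 0)"
proof -
  have n: "n > 0" using assms by (auto intro: Nat.gr0I)
  obtain m where m: "real n + 1 = 2 * real m" using assms
    by (auto elim!: oddE intro: that[of "Suc _"])
  define w where "w = cis (2 * pi * of_int k / n)"
  have grid_eq: "of_int k * grid n l = real l * (2 * pi * of_int k / n) + (- real m * (2 * pi * of_int k / n))" for l
    using n m by (simp add: grid_def field_simps)
  have cis_eq: "cis (of_int k * grid n l) = w ^ l * cis (- real m * (2 * pi * of_int k / n))" for l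
    unfolding grid_eq w_def by (simp add: Complex.DeMoivre cis_mult)
  show ?thesis
  proof (cases "int n dvd k")
    case True
    then obtain j where j: "k = int n * j" by blast
    have "of_int k * grid n l = 2 * pi * of_int (j * (int l - int m))" for l
      unfolding grid_eq by (use n in \<open>simp add: j field_simps\<close>)
    then have "cis (of_int k * grid n l) = 1" for l by (simp only: cis_multiple_2pi Ints_of_int)
    then show ?thesis using True by simp
  next
    case False
    have "w \<noteq> 1"
    proof
      assume "w = 1"
      then have "cos (2 * pi * of_int k / n) = 1" by (simp add: w_def complex_eq_iff)
      then obtain j :: int where "2 * pi * of_int k / n = of_int j * 2 * pi"
        unfolding cos_one_2pi_int by blast
      then have "real_of_int k = of_int (j * int n)" using n by (simp add: field_simps)
      then have "k = j * int n" by linarith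
      then show False using False by simp
    qed
    moreover have "w ^ n = 1"
    proof -
      have "w ^ n = cis (2 * pi * of_int k)" using n by (simp add: w_def Complex.DeMoivre)
      then show ?thesis by (simp add: cis_multiple_2pi)
    qed
    moreover have "(\<Sum>l=1..n. w ^ l) = w * (\<Sum>l<n. w ^ l)"
      by (simp add: sum_distrib_left sum.atLeast1_atMost_eq)
    ultimately have "(\<Sum>l=1..n. w ^ l) = 0" by (simp add: geometric_sum)
    then show ?thesis using False by (simp add: cis_eq flip: sum_distrib_right)
  qed
qed

lemma sum_trig_grid:
  assumes "odd n"
  shows "(\<Sum>l=1..n. cos (of_int k * grid n l)) = (if int n dvd k then real n else 0)"
    and "(\<Sum>l=1..n. sin (of_int k * grid n l)) = 0"
  using arg_cong[OF sum_cis_grid[OF assms, of k], of Re] arg_cong[OF sum_cis_grid[OF assms, of k], of Im]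
  by (simp_all split: if_splits)

lemma grid_in_range:
  assumes "1 \<le> l" "l \<le> n"
  shows "grid n l \<in> {-pi..pi}"
proof -
  have n: "real n > 0" using assms by simp
  have "grid n l = (2 * real l - (real n + 1)) / real n * pi"
    using n by (simp add: grid_def field_simps)
  moreover have "-1 \<le> (2 * real l - (real n + 1)) / real n" "(2 * real l - (real n + 1)) / real n \<le> 1"
    using assms by (auto simp: field_simps)
  then have "-1 * pi \<le> (2 * real l - (real n + 1)) / real n * pi" "(2 * real l - (real n + 1)) / real n * pi \<le> 1 * pi"
    by (intro mult_right_mono; simp)+
  ultimately show ?thesis by simp
qed

text \<open>The real coefficients of one order \<open>j\<close> are numbered by \<open>q\<close>: 0 and 1 are the cosine coefficients of
the two coordinates of the plane, 2 and 3 the sine coefficients. For \<open>j = 0\<close> only the first two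
exist.\<close>
definition harmonic :: "nat \<Rightarrow> real \<Rightarrow> real" where
  "harmonic q x = (if q < 2 then cos x else sin x)"

definition coord :: "nat \<Rightarrow> 2" where
  "coord q = (if even q then 1 else 2)"

definition dof :: "nat \<Rightarrow> nat" where
  "dof j = (if j = 0 then 2 else 4)"

definition sample_coeff :: "nat \<Rightarrow> nat \<Rightarrow> nat \<Rightarrow> (real \<Rightarrow> real) \<Rightarrow> real" where
  "sample_coeff n j q g =
     (if j = 0 then 1 else 2) / real n * (\<Sum>l=1..n. harmonic q (real j * grid n l) * g (grid n l))"

text \<open>What sampling on the grid makes of the harmonic of order \<open>k\<close>: its contribution to the coefficient of
order \<open>j\<close>.\<close>
definition alias_coeff :: "nat \<Rightarrow> nat \<Rightarrow> nat \<Rightarrow> nat \<Rightarrow> real" where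
  "alias_coeff n j q k = sample_coeff n j q (\<lambda>\<theta>. harmonic q (real k * \<theta>))"

lemma sum_harmonic_grid:
  assumes "odd n"
  shows "(\<Sum>l=1..n. cos (real j * grid n l) * cos (real k * grid n l)) =
      real n / 2 * (of_bool (int n dvd int k - int j) + of_bool (int n dvd int k + int j))"
    and "(\<Sum>l=1..n. sin (real j * grid n l) * sin (real k * grid n l)) =
      real n / 2 * (of_bool (int n dvd int k - int j) - of_bool (int n dvd int k + int j))"
    and "(\<Sum>l=1..n. sin (real j * grid n l) * cos (real k * grid n l)) = 0"
proof -
  note s = sum_trig_grid[OF assms, of "int k - int j"] sum_trig_grid[OF assms, of "int k + int j"]
  have "(\<Sum>l=1..n. cos (real j * grid n l) * cos (real k * grid n l)) =
     ((\<Sum>l=1..n. cos (of_int (int k - int j) * grid n l)) + (\<Sum>l=1..n. cos (of_int (int k + int j) * grid n l))) / 2"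
    unfolding sum.distrib[symmetric] sum_divide_distrib
    by (intro sum.cong refl) (simp add: cos_times_cos[of "real k * _"] left_diff_distrib distrib_right mult.commute[of "cos (real j * _)"])
  then show "(\<Sum>l=1..n. cos (real j * grid n l) * cos (real k * grid n l)) =
      real n / 2 * (of_bool (int n dvd int k - int j) + of_bool (int n dvd int k + int j))"
    unfolding s by auto
  have "(\<Sum>l=1..n. sin (real j * grid n l) * sin (real k * grid n l)) =
     ((\<Sum>l=1..n. cos (of_int (int k - int j) * grid n l)) - (\<Sum>l=1..n. cos (of_int (int k + int j) * grid n l))) / 2"
    unfolding sum_subtractf[symmetric] sum_divide_distrib
    by (intro sum.cong refl) (simp add: sin_times_sin[of "real k * _"] left_diff_distrib distrib_right mult.commute[of "sin (real j * _)"])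
  then show "(\<Sum>l=1..n. sin (real j * grid n l) * sin (real k * grid n l)) =
      real n / 2 * (of_bool (int n dvd int k - int j) - of_bool (int n dvd int k + int j))"
    unfolding s by auto
  have "(\<Sum>l=1..n. sin (real j * grid n l) * cos (real k * grid n l)) =
     ((\<Sum>l=1..n. sin (of_int (int k + int j) * grid n l)) - (\<Sum>l=1..n. sin (of_int (int k - int j) * grid n l))) / 2"
    unfolding sum_subtractf[symmetric] sum_divide_distrib
    by (intro sum.cong refl) (simp add: cos_times_sin[of "real k * _"] left_diff_distrib distrib_right mult.commute[of "sin (real j * _)"])
  then show "(\<Sum>l=1..n. sin (real j * grid n l) * cos (real k * grid n l)) = 0"
    unfolding s by simp
qed

text \<open>An order \<open>k\<close> is aliased to at most one order below \<open>n / 2\<close>, because two such orders have sum and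
difference smaller than \<open>n\<close>. Independence of the errors across orders rests on this.\<close>
lemma dvd_aliases:
  assumes "real j < real n / 2" "real j' < real n / 2"
    and "int n dvd int k - int j \<or> int n dvd int k + int j"
    and "int n dvd int k - int j' \<or> int n dvd int k + int j'"
  shows "j = j'"
proof -
  have small: "m = 0" if "int n dvd m" "\<bar>m\<bar> < int n" for m
    using that dvd_imp_le_int[of m "int n"] by fastforce
  have "int n dvd int j - int j' \<or> int n dvd int j + int j'"
  proof -
    have "int n dvd (int k - a) - (int k - b) \<Longrightarrow> int n dvd a - b" for a b
      using dvd_minus_iff[of "int n" "a - b"] by simp
    then have *: "int n dvd int k - a \<Longrightarrow> int n dvd int k - b \<Longrightarrow> int n dvd a - b" for a b
      using dvd_diff by blast
    have **: "int n dvd - a - b \<Longrightarrow> int n dvd a + b" for a b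
      using dvd_minus_iff[of "int n" "a + b"] by (simp add: algebra_simps)
    show ?thesis
      using assms(3,4) *[of "int j" "int j'"] *[of "int j" "- int j'"] *[of "- int j" "int j'"]
        *[of "- int j" "- int j'"] **[of "int j" "int j'"] dvd_diff_commute[of "int n" "int j" "int j'"]
      by auto
  qed
  then show ?thesis using assms(1,2) small[of "int j - int j'"] small[of "int j + int j'"] by auto
qed

text \<open>The coefficient takes only the values 0, 1 and -1, and -1 occurs for a sine with \<open>k\<close> congruent to \<open>-j\<close>.
For \<open>j > 0\<close> the value 2 is excluded, since both congruences together would make \<open>n\<close> divide \<open>2 * j\<close>;
for \<open>j = 0\<close> they coincide, which the normalisation of \<open>sample_coeff\<close> takes into account. The square
therefore is the coefficient of the cosine.\<close>
lemma alias_coeff_cases: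
  assumes "odd n" "real j < real n / 2" "q < dof j"
  shows "(alias_coeff n j q k)\<^sup>2 = alias_coeff n j 0 k"
    and "alias_coeff n j q k \<noteq> 0 \<longleftrightarrow> int n dvd int k - int j \<or> int n dvd int k + int j"
proof -
  have n: "n > 0" using assms by (auto intro: Nat.gr0I)
  have not_both: "\<not> (int n dvd int k - int j \<and> int n dvd int k + int j)" if "j > 0"
  proof
    assume "int n dvd int k - int j \<and> int n dvd int k + int j"
    then have "int n dvd (int k + int j) - (int k - int j)" by (blast intro: dvd_diff)
    then have "int n dvd 2 * int j" by simp
    then show False using zdvd_imp_le[of "int n" "2 * int j"] assms(2) that by auto
  qed
  have "alias_coeff n j q k = (if j = 0 then of_bool (int n dvd int k)
     else if q < 2 then of_bool (int n dvd int k - int j) + of_bool (int n dvd int k + int j)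
     else of_bool (int n dvd int k - int j) - of_bool (int n dvd int k + int j))"
    if "q < dof j" for q
  proof (cases "j = 0")
    case True
    then show ?thesis using that n sum_harmonic_grid(1)[OF assms(1), of 0 k]
      by (simp add: alias_coeff_def sample_coeff_def harmonic_def dof_def)
  next
    case False
    then show ?thesis using that n
      by (cases "q < 2") (simp_all only: alias_coeff_def sample_coeff_def harmonic_def sum_harmonic_grid(1,2)[OF assms(1)] if_True if_False; simp)+
  qed
  from this[OF assms(3)] this[of 0]
  show "(alias_coeff n j q k)\<^sup>2 = alias_coeff n j 0 k"
    and "alias_coeff n j q k \<noteq> 0 \<longleftrightarrow> int n dvd int k - int j \<or> int n dvd int k + int j"
    using not_both by (cases "j = 0"; auto simp: dof_def)+
qed

text \<open>Sines and cosines are orthogonal on the grid, so each sampled coefficient sees only one of the two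
random amplitudes of a given order.\<close>
lemma sample_coeff_series_term:
  assumes "odd n"
  shows "sample_coeff n j q (\<lambda>\<theta>. x * cos (real k * \<theta>) + y * sin (real k * \<theta>)) =
    alias_coeff n j q k * (if q < 2 then x else y)"
proof -
  have "sample_coeff n j q (\<lambda>\<theta>. x * cos (real k * \<theta>) + y * sin (real k * \<theta>)) =
     x * sample_coeff n j q (\<lambda>\<theta>. cos (real k * \<theta>)) + y * sample_coeff n j q (\<lambda>\<theta>. sin (real k * \<theta>))"
    by (simp add: sample_coeff_def sum.distrib sum_distrib_left algebra_simps)
  moreover have "sample_coeff n j q (\<lambda>\<theta>. if q < 2 then sin (real k * \<theta>) else cos (real k * \<theta>)) = 0"
    using sum_harmonic_grid(3)[OF assms, of j k] sum_harmonic_grid(3)[OF assms, of k j]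
    by (cases "q < 2") (simp_all add: sample_coeff_def harmonic_def mult.commute)
  ultimately show ?thesis by (auto simp: alias_coeff_def harmonic_def)
qed

lemma sample_coeff_sums:
  assumes "\<And>l. l \<in> {1..n} \<Longrightarrow> (\<lambda>k. f k (grid n l)) sums g (grid n l)"
  shows "(\<lambda>k. sample_coeff n j q (f k)) sums sample_coeff n j q g"
  unfolding sample_coeff_def by (intro sums_mult sums_sum assms)

lemma sample_coeff_add:
  "sample_coeff n j q (\<lambda>\<theta>. f \<theta> + g \<theta>) = sample_coeff n j q f + sample_coeff n j q g"
  by (simp add: sample_coeff_def sum.distrib distrib_left)

lemma sample_coeff_mean:
  "sample_coeff n j q (\<lambda>\<theta>. c * (\<Sum>t\<in>S. f t \<theta>)) = c * (\<Sum>t\<in>S. sample_coeff n j q (f t))"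
proof -
  let ?h = "\<lambda>l. harmonic q (real j * grid n l)"
  have "(\<Sum>l=1..n. ?h l * (c * (\<Sum>t\<in>S. f t (grid n l)))) = (\<Sum>l=1..n. \<Sum>t\<in>S. c * (?h l * f t (grid n l)))"
    by (simp add: sum_distrib_left mult_ac)
  also have "\<dots> = (\<Sum>t\<in>S. \<Sum>l=1..n. c * (?h l * f t (grid n l)))" by (rule sum.swap)
  finally show ?thesis unfolding sample_coeff_def by (simp add: sum_distrib_left mult_ac)
qed

lemma grid_var_eq_sample_coeff: "grid_var \<sigma> n j = sample_coeff n j 0 (noise_cov \<sigma>)"
  by (simp add: grid_var_def sample_coeff_def harmonic_def mult.commute)

text \<open>The variance \<open>grid_var\<close> is the sampled cosine coefficient of the covariance function, that is, the
total variance of the orders \<open>k\<close> that are aliased to \<open>j\<close>.\<close>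
lemma grid_var_sums:
  assumes \<sigma>: "summable (\<lambda>k. (\<sigma> k)\<^sup>2)" and "odd n" "real j < real n / 2" "q < dof j"
  shows "(\<lambda>k. (alias_coeff n j q k * \<sigma> k)\<^sup>2) sums grid_var \<sigma> n j"
proof -
  have "(\<lambda>k. (\<sigma> k)\<^sup>2 * cos (real k * \<theta>)) sums noise_cov \<sigma> \<theta>" for \<theta>
    unfolding noise_cov_def
  proof (rule summable_sums, rule summable_comparison_test'[OF \<sigma>])
    show "norm ((\<sigma> k)\<^sup>2 * cos (real k * \<theta>)) \<le> (\<sigma> k)\<^sup>2" for k
      by (simp add: abs_mult mult_left_le)
  qed
  then have "(\<lambda>k. sample_coeff n j 0 (\<lambda>\<theta>. (\<sigma> k)\<^sup>2 * cos (real k * \<theta>))) sums grid_var \<sigma> n j"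
    unfolding grid_var_eq_sample_coeff by (intro sample_coeff_sums)
  moreover have "sample_coeff n j 0 (\<lambda>\<theta>. (\<sigma> k)\<^sup>2 * cos (real k * \<theta>)) = (alias_coeff n j q k * \<sigma> k)\<^sup>2" for k
    using sample_coeff_series_term[OF assms(2), of j 0 "(\<sigma> k)\<^sup>2" k 0]
    by (simp add: power_mult_distrib alias_coeff_cases(1)[OF assms(2-4)] dof_def)
  ultimately show ?thesis by simp
qed

section \<open>The estimator in Fourier coordinates\<close>

lemma power2_norm_real2: "(norm (x::real^2))\<^sup>2 = (x $ 1)\<^sup>2 + (x $ 2)\<^sup>2"
  unfolding power2_norm_eq_inner by (simp add: inner_vec_def sum_2 power2_eq_square)

lemma sum_coord:
  fixes f :: "nat \<Rightarrow> real"
  shows "(\<Sum>q<dof j. f q) = (if j = 0 then f 0 + f 1 else f 0 + f 1 + f 2 + f 3)"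
  by (simp add: dof_def eval_nat_numeral)

lemma coord_simps [simp]: "coord 0 = 1" "coord (Suc 0) = 2" "coord 2 = 1" "coord 3 = 2"
  by (simp_all add: coord_def)

text \<open>The coefficient of \<open>\<Gamma>\<close> that \<open>sample_coeff n j q\<close> approximates.\<close>
definition true_coeff :: "(real \<Rightarrow> real^2) \<Rightarrow> nat \<Rightarrow> nat \<Rightarrow> real" where
  "true_coeff \<Gamma> j q = (if q < 2 then fourier_cos \<Gamma> j else fourier_sin \<Gamma> j) $ coord q"

definition aliasing_error :: "nat \<Rightarrow> (real \<Rightarrow> real^2) \<Rightarrow> nat \<Rightarrow> nat \<Rightarrow> real" where
  "aliasing_error n \<Gamma> j q = sample_coeff n j q (\<lambda>\<theta>. \<Gamma> \<theta> $ coord q) - true_coeff \<Gamma> j q"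

lemma aliasing_eq_sum: "aliasing n \<Gamma> j = (\<Sum>q<dof j. (aliasing_error n \<Gamma> j q)\<^sup>2)"
  by (auto simp: sum_coord aliasing_def power2_norm_real2 aliasing_error_def true_coeff_def sample_coeff_def
      harmonic_def riemann_cos_def riemann_sin_def)

lemma fourier_component:
  assumes "continuous_on {-pi..pi} \<Gamma>"
  shows "fourier_cos \<Gamma> j $ i = cos_fourier (\<lambda>\<theta>. \<Gamma> \<theta> $ i) j"
    and "fourier_sin \<Gamma> j $ i = sin_fourier (\<lambda>\<theta>. \<Gamma> \<theta> $ i) j"
proof -
  have "(\<lambda>\<theta>. cos (real j * \<theta>) *\<^sub>R \<Gamma> \<theta>) integrable_on {-pi..pi}"
    "(\<lambda>\<theta>. sin (real j * \<theta>) *\<^sub>R \<Gamma> \<theta>) integrable_on {-pi..pi}" "\<Gamma> integrable_on {-pi..pi}"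
    by (intro integrable_continuous_real continuous_intros assms)+
  from this[THEN integral_component_eq_cart, of i]
  show "fourier_cos \<Gamma> j $ i = cos_fourier (\<lambda>\<theta>. \<Gamma> \<theta> $ i) j"
    and "fourier_sin \<Gamma> j $ i = sin_fourier (\<lambda>\<theta>. \<Gamma> \<theta> $ i) j"
    by (simp_all add: fourier_cos_def fourier_sin_def cos_fourier_def sin_fourier_def)
qed

text \<open>By the addition theorem for \<open>cos (j * (\<theta> - grid n l))\<close> the weights build the trigonometric sum with
the sampled coefficients.\<close>
lemma weight_interpolation:
  "(\<Sum>l=1..n. weight n J l \<theta> * g (grid n l)) =
     trig_sum (\<lambda>j. sample_coeff n j 0 g) (\<lambda>j. sample_coeff n j 2 g) J \<theta>"
proof -
  have "(\<Sum>l=1..n. weight n J l \<theta> * g (grid n l)) =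
      (\<Sum>l=1..n. 1 / real n * g (grid n l)
        + (\<Sum>j=1..J. 2 / real n * cos (real j * (\<theta> - grid n l)) * g (grid n l)))"
    by (simp add: weight_def sum_distrib_left sum_distrib_right distrib_right)
  also have "\<dots> = (\<Sum>l=1..n. 1 / real n * g (grid n l))
      + (\<Sum>l=1..n. \<Sum>j=1..J. 2 / real n * cos (real j * (\<theta> - grid n l)) * g (grid n l))"
    by (rule sum.distrib)
  also have "(\<Sum>l=1..n. \<Sum>j=1..J. 2 / real n * cos (real j * (\<theta> - grid n l)) * g (grid n l)) =
      (\<Sum>j=1..J. \<Sum>l=1..n. 2 / real n * cos (real j * (\<theta> - grid n l)) * g (grid n l))"
    by (rule sum.swap)
  also have "\<dots> = (\<Sum>j=1..J. sample_coeff n j 0 g * cos (real j * \<theta>) + sample_coeff n j 2 g * sin (real j * \<theta>))"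
    by (intro sum.cong refl)
      (simp add: sample_coeff_def harmonic_def right_diff_distrib cos_diff sum_distrib_left sum_distrib_right
        sum.distrib[symmetric] algebra_simps)
  also have "(\<Sum>l=1..n. 1 / real n * g (grid n l)) = sample_coeff n 0 0 g"
    by (simp add: sample_coeff_def harmonic_def sum_distrib_left)
  finally show ?thesis by (simp add: trig_sum_def)
qed

lemma curve_estimator_component:
  "curve_estimator n J T x \<theta> $ i =
     trig_sum (\<lambda>j. sample_coeff n j 0 (\<lambda>\<phi>. 1 / (real T + 1) * (\<Sum>t=0..T. x t \<phi> $ i)))
       (\<lambda>j. sample_coeff n j 2 (\<lambda>\<phi>. 1 / (real T + 1) * (\<Sum>t=0..T. x t \<phi> $ i))) J \<theta>"
proof -
  have "curve_estimator n J T x \<theta> $ i =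
      1 / (real T + 1) * (\<Sum>t=0..T. \<Sum>l=1..n. weight n J l \<theta> * x t (grid n l) $ i)"
    by (simp add: curve_estimator_def)
  also have "\<dots> = 1 / (real T + 1) * (\<Sum>l=1..n. \<Sum>t=0..T. weight n J l \<theta> * x t (grid n l) $ i)"
    by (subst sum.swap) simp
  also have "\<dots> = (\<Sum>l=1..n. weight n J l \<theta> * (1 / (real T + 1) * (\<Sum>t=0..T. x t (grid n l) $ i)))"
    by (simp add: sum_distrib_left mult_ac)
  also have "\<dots> = trig_sum (\<lambda>j. sample_coeff n j 0 (\<lambda>\<phi>. 1 / (real T + 1) * (\<Sum>t=0..T. x t \<phi> $ i)))
       (\<lambda>j. sample_coeff n j 2 (\<lambda>\<phi>. 1 / (real T + 1) * (\<Sum>t=0..T. x t \<phi> $ i))) J \<theta>"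
    by (rule weight_interpolation[where g = "\<lambda>\<phi>. 1 / (real T + 1) * (\<Sum>t=0..T. x t \<phi> $ i)"])
  finally show ?thesis .
qed

definition noise_coeff :: "nat \<Rightarrow> (nat \<Rightarrow> real \<Rightarrow> real^2) \<Rightarrow> nat \<Rightarrow> nat \<Rightarrow> nat \<Rightarrow> real" where
  "noise_coeff n x j q t = sample_coeff n j q (\<lambda>\<theta>. x t \<theta> $ coord q)"

definition mean_noise :: "nat \<Rightarrow> (nat \<Rightarrow> real \<Rightarrow> real^2) \<Rightarrow> nat \<Rightarrow> nat \<Rightarrow> nat \<Rightarrow> real" where
  "mean_noise n x T j q = 1 / (real T + 1) * (\<Sum>t=0..T. noise_coeff n x j q t)"

lemma sample_coeff_mean_observation:
  "sample_coeff n j q (\<lambda>\<phi>. 1 / (real T + 1) * (\<Sum>t=0..T. (\<Gamma> \<phi> + x t \<phi>) $ coord q)) =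
     true_coeff \<Gamma> j q + (aliasing_error n \<Gamma> j q + mean_noise n x T j q)"
  unfolding sample_coeff_mean
  by (simp add: sample_coeff_add sum.distrib aliasing_error_def mean_noise_def noise_coeff_def field_simps)

lemma sample_coeff_cong_harmonic:
  assumes "q < 2 \<longleftrightarrow> q' < 2" shows "sample_coeff n j q = sample_coeff n j q'"
  using assms by (simp add: sample_coeff_def harmonic_def fun_eq_iff)

text \<open>A pathwise statement: \<open>x\<close> is one realisation of the noise. In each coordinate of the plane the
estimator is a trigonometric sum of degree \<open>J\<close> whose coefficients differ from the Fourier
coefficients of \<open>\<Gamma>\<close> by an aliasing error and the averaged noise.\<close>
theorem integrated_square_error:
  fixes x :: "nat \<Rightarrow> real \<Rightarrow> real^2" and n J T :: nat
  assumes \<Gamma>: "continuous_on {-pi..pi} \<Gamma>" "\<Gamma> (-pi) = \<Gamma> pi"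
  defines "e \<equiv> \<lambda>j q. aliasing_error n \<Gamma> j q + mean_noise n x T j q"
  shows "(\<lambda>j. (norm (fourier_cos \<Gamma> (J + 1 + j)))\<^sup>2 + (norm (fourier_sin \<Gamma> (J + 1 + j)))\<^sup>2) sums
    (1 / pi * integral {-pi..pi}
         (\<lambda>\<theta>. (norm (curve_estimator n J T (\<lambda>t \<phi>. \<Gamma> \<phi> + x t \<phi>) \<theta> - \<Gamma> \<theta>))\<^sup>2)
      - (2 * (\<Sum>q<dof 0. (e 0 q)\<^sup>2) + (\<Sum>j=1..J. \<Sum>q<dof j. (e j q)\<^sup>2)))"
proof -
  define est where "est = curve_estimator n J T (\<lambda>t \<phi>. \<Gamma> \<phi> + x t \<phi>)"
  define a where "a i j = sample_coeff n j 0 (\<lambda>\<phi>. 1 / (real T + 1) * (\<Sum>t=0..T. (\<Gamma> \<phi> + x t \<phi>) $ i))" for i j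
  define b where "b i j = sample_coeff n j 2 (\<lambda>\<phi>. 1 / (real T + 1) * (\<Sum>t=0..T. (\<Gamma> \<phi> + x t \<phi>) $ i))" for i j
  let ?\<Gamma> = "\<lambda>i \<theta>. \<Gamma> \<theta> $ i"
  have cont: "continuous_on {-pi..pi} (?\<Gamma> i)" for i by (intro continuous_intros \<Gamma>)
  have est: "est \<theta> $ i = trig_sum (a i) (b i) J \<theta>" for \<theta> i
    unfolding est_def a_def b_def curve_estimator_component ..
  have a: "a 1 j - cos_fourier (?\<Gamma> 1) j = e j 0" "a 2 j - cos_fourier (?\<Gamma> 2) j = e j 1"
    "b 1 j - sin_fourier (?\<Gamma> 1) j = e j 2" "b 2 j - sin_fourier (?\<Gamma> 2) j = e j 3" for j
    using sample_coeff_mean_observation[of n j 0 T \<Gamma> x] sample_coeff_mean_observation[of n j 1 T \<Gamma> x]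
      sample_coeff_mean_observation[of n j 2 T \<Gamma> x] sample_coeff_mean_observation[of n j 3 T \<Gamma> x]
      sample_coeff_cong_harmonic[of 0 1 n j] sample_coeff_cong_harmonic[of 2 3 n j]
    by (simp_all add: a_def b_def e_def true_coeff_def fourier_component[OF \<Gamma>(1)])
  have "integral {-pi..pi} (\<lambda>\<theta>. (norm (est \<theta> - \<Gamma> \<theta>))\<^sup>2) =
      integral {-pi..pi} (\<lambda>\<theta>. (?\<Gamma> 1 \<theta> - trig_sum (a 1) (b 1) J \<theta>)\<^sup>2 + (?\<Gamma> 2 \<theta> - trig_sum (a 2) (b 2) J \<theta>)\<^sup>2)"
    by (simp add: power2_norm_real2 est power2_commute)
  also have "\<dots> = integral {-pi..pi} (\<lambda>\<theta>. (?\<Gamma> 1 \<theta> - trig_sum (a 1) (b 1) J \<theta>)\<^sup>2)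
      + integral {-pi..pi} (\<lambda>\<theta>. (?\<Gamma> 2 \<theta> - trig_sum (a 2) (b 2) J \<theta>)\<^sup>2)"
    by (intro Henstock_Kurzweil_Integration.integral_add integrable_continuous_real continuous_intros cont)
  finally have int: "integral {-pi..pi} (\<lambda>\<theta>. (norm (est \<theta> - \<Gamma> \<theta>))\<^sup>2) = \<dots>" .
  have energy: "trig_energy (\<lambda>j. e j 0) (\<lambda>j. e j 2) J + trig_energy (\<lambda>j. e j 1) (\<lambda>j. e j 3) J =
     2 * (\<Sum>q<dof 0. (e 0 q)\<^sup>2) + (\<Sum>j=1..J. \<Sum>q<dof j. (e j q)\<^sup>2)"
  proof -
    have "(\<Sum>j=1..J. \<Sum>q<dof j. (e j q)\<^sup>2) =
        (\<Sum>j=1..J. ((e j 0)\<^sup>2 + (e j 2)\<^sup>2) + ((e j 1)\<^sup>2 + (e j 3)\<^sup>2))"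
      by (intro sum.cong) (auto simp: sum_coord)
    then show ?thesis by (simp add: trig_energy_def sum.distrib sum_coord)
  qed
  have tail: "(\<lambda>j. (cos_fourier (?\<Gamma> i) (J + 1 + j))\<^sup>2 + (sin_fourier (?\<Gamma> i) (J + 1 + j))\<^sup>2) sums
     (1 / pi * integral {-pi..pi} (\<lambda>\<theta>. (?\<Gamma> i \<theta> - trig_sum (a i) (b i) J \<theta>)\<^sup>2)
       - trig_energy (\<lambda>j. a i j - cos_fourier (?\<Gamma> i) j) (\<lambda>j. b i j - sin_fourier (?\<Gamma> i) j) J)" for i
    by (rule integral_square_diff_trig_sum_tail[OF cont]) (simp add: \<Gamma>(2))
  from sums_add[OF tail[of 1] tail[of 2]] show ?thesis
    unfolding a est_def[symmetric] int energy[symmetric]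
    by (simp add: power2_norm_real2 fourier_component[OF \<Gamma>(1)] algebra_simps)
qed

section \<open>The law of the noise in the sampled coefficients\<close>

context curve_noise
begin

definition coeff :: "(nat \<times> nat \<times> 2) + (nat \<times> nat \<times> 2) \<Rightarrow> 'w \<Rightarrow> real" where
  "coeff = case_sum (\<lambda>(t, j, i). A t j i) (\<lambda>(t, j, i). B t j i)"

text \<open>The random amplitude of order \<open>k\<close> at time \<open>t\<close> that enters the coefficients numbered \<open>q\<close>.\<close>
definition coeff_index :: "nat \<Rightarrow> nat \<Rightarrow> nat \<Rightarrow> (nat \<times> nat \<times> 2) + (nat \<times> nat \<times> 2)" where
  "coeff_index q t k = (if q < 2 then Inl (t, k, coord q) else Inr (t, k, coord q))"

lemma indep_vars_coeff: "indep_vars (\<lambda>_. borel) coeff UNIV"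
  using coeff_indep by (simp add: coeff_def)

lemma coeff_index_inj:
  assumes "coeff_index q t k = coeff_index q' t' k'" "q < 4" "q' < 4"
  shows "q = q'" "t = t'" "k = k'"
proof -
  have "q \<in> {0, 1, 2, 3}" "q' \<in> {0, 1, 2, 3}" using assms(2,3) by auto
  then show "q = q'" "t = t'" "k = k'" using assms(1) by (auto simp: coeff_index_def)
qed

lemma distr_coeff: "distr M borel (coeff (coeff_index q t k)) = gaussian 0 (\<sigma> k)"
  by (simp add: coeff_def coeff_index_def A_law B_law)

lemma summable_var: "summable (\<lambda>k. (\<sigma> k)\<^sup>2)"
proof -
  obtain \<epsilon> where \<epsilon>: "\<epsilon> > 0" "summable (\<lambda>j. real j powr (2 + \<epsilon>) * (\<sigma> j)\<^sup>2)" using var_decay by blast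
  show ?thesis
  proof (rule summable_comparison_test'[OF \<epsilon>(2), where N = 1])
    fix k :: nat assume "k \<ge> 1"
    then have "1 \<le> real k powr (2 + \<epsilon>)" using \<epsilon>(1) by (intro ge_one_powr_ge_zero) auto
    then show "norm ((\<sigma> k)\<^sup>2) \<le> real k powr (2 + \<epsilon>) * (\<sigma> k)\<^sup>2"
      using mult_right_mono[of 1 "real k powr (2 + \<epsilon>)" "(\<sigma> k)\<^sup>2"] by simp
  qed
qed

abbreviation noise :: "nat \<Rightarrow> nat \<Rightarrow> nat \<Rightarrow> nat \<Rightarrow> 'w \<Rightarrow> real" where
  "noise n j q t \<omega> \<equiv> noise_coeff n (\<lambda>t \<theta>. N t \<theta> \<omega>) j q t"

lemma measurable_noise [measurable]: "random_variable borel (noise n j q t)"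
proof -
  have "random_variable borel (\<lambda>\<omega>. N t (grid n l) \<omega> $ i)" if "l \<in> {1..n}" for l i
    using N_measurable[OF grid_in_range, of l n t] that
    by (intro borel_measurable_continuous_on[where f = "\<lambda>x. x $ i"] continuous_intros) auto
  then show ?thesis
    unfolding noise_coeff_def sample_coeff_def
    by (intro borel_measurable_times borel_measurable_sum borel_measurable_const) auto
qed

text \<open>A sampled coefficient is a finite linear combination of grid values, so it may be taken inside the
random series; the terms of the result vanish unless \<open>k\<close> is aliased to \<open>j\<close>.\<close>
lemma noise_series:
  assumes "odd n"
  shows "AE \<omega> in M. (\<lambda>k. alias_coeff n j q k * coeff (coeff_index q t k) \<omega>) sums noise n j q t \<omega>"
proof -
  have "AE \<omega> in M. \<forall>l\<in>{1..n}. (\<lambda>k. A t k (coord q) \<omega> * cos (real k * grid n l) + B t k (coord q) \<omega> * sin (real k * grid n l))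
                   sums (N t (grid n l) \<omega> $ coord q)"
    using N_series[OF grid_in_range] by (intro AE_finite_allI) auto
  then show ?thesis
  proof eventually_elim
    case (elim \<omega>)
    then have "(\<lambda>k. sample_coeff n j q (\<lambda>\<theta>. A t k (coord q) \<omega> * cos (real k * \<theta>) + B t k (coord q) \<omega> * sin (real k * \<theta>)))
        sums noise n j q t \<omega>"
      unfolding noise_coeff_def by (intro sample_coeff_sums) auto
    then show ?case
      unfolding sample_coeff_series_term[OF assms] by (cases "q < 2") (simp_all add: coeff_def coeff_index_def)
  qed
qed

lemma distr_noise:
  assumes "odd n" "real j < real n / 2" "q < dof j"
  shows "distr M borel (noise n j q t) = gaussian 0 (sqrt (grid_var \<sigma> n j))"
proof (rule gaussian_series)
  have "q < 4" using assms(3) by (simp add: dof_def split: if_splits)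
  then show "indep_vars (\<lambda>_. borel) (\<lambda>k. coeff (coeff_index q t k)) UNIV"
    by (intro indep_vars_reindex_inj[OF indep_vars_coeff]) (auto intro!: injI dest: coeff_index_inj)
qed (use assms in \<open>auto intro: noise_series grid_var_sums summable_var simp: distr_coeff\<close>)

text \<open>Almost surely the noise coefficients are series over disjoint sets of the independent amplitudes:
different \<open>q\<close> or \<open>t\<close> use different families of amplitudes, and different \<open>j\<close> use different
residue classes of orders.\<close>
lemma indep_vars_noise:
  assumes "odd n" "real J < real n / 2"
  shows "indep_vars (\<lambda>_. borel) (\<lambda>(j, q, t). noise n j q t) {(j, q, t). j \<le> J \<and> q < dof j}"
    (is "indep_vars _ _ ?I")
proof (rule indep_vars_AE_cong)
  define K where "K = (\<lambda>(j, q, t). coeff_index q t ` {k. alias_coeff n j q k \<noteq> 0})"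
  \<comment> \<open>outside the block x is undefined, and the inner case distinction makes F measurable there\<close>
  define F where "F = (\<lambda>(j, q, t) x. \<Sum>k. alias_coeff n j q k *
      (if alias_coeff n j q k = 0 then 0 else x (coeff_index q t k) :: real))"
  have dof4: "q < 4" if "q < dof j" for q j using that by (simp add: dof_def split: if_splits)
  have half: "real j < real n / 2" if "j \<le> J" for j using that assms(2) by simp
  show "indep_vars (\<lambda>_. borel)
      (\<lambda>(j, q, t) \<omega>. \<Sum>k. alias_coeff n j q k * coeff (coeff_index q t k) \<omega>) ?I"
  proof (rule indep_vars_blockwise[OF indep_vars_coeff, where K = K and F = F])
    show "disjoint_family_on K ?I"
      unfolding disjoint_family_on_def
    proof (intro ballI impI, rule ccontr)
      fix p p' assume "p \<in> ?I" "p' \<in> ?I" "p \<noteq> p'" "K p \<inter> K p' \<noteq> {}"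
      moreover obtain j q t j' q' t' where p: "p = (j, q, t)" "p' = (j', q', t')"
        by (cases p, cases p') blast
      ultimately have le: "j \<le> J" "q < dof j" "j' \<le> J" "q' < dof j'" by auto
      obtain k k' where eq: "coeff_index q t k = coeff_index q' t' k'"
        "alias_coeff n j q k \<noteq> 0" "alias_coeff n j' q' k' \<noteq> 0"
        using \<open>K p \<inter> K p' \<noteq> {}\<close> by (auto simp: K_def p)
      from coeff_index_inj[OF eq(1) dof4[OF le(2)] dof4[OF le(4)]]
      have same: "q = q'" "t = t'" "k = k'" by auto
      have "j = j'"
        using eq(2,3) dvd_aliases[OF half[OF le(1)] half[OF le(3)], of k]
        by (simp add: same alias_coeff_cases(2)[OF assms(1) half[OF le(1)]] le(2)[unfolded same]
            alias_coeff_cases(2)[OF assms(1) half[OF le(3)] le(4)])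
      then show False using \<open>p \<noteq> p'\<close> p same by simp
    qed
    show "F p \<in> borel_measurable (\<Pi>\<^sub>M i\<in>K p. borel)" for p
    proof -
      obtain j q t where p: "p = (j, q, t)" by (cases p)
      have "(\<lambda>x. if alias_coeff n j q k = 0 then 0 else x (coeff_index q t k) :: real)
          \<in> borel_measurable (\<Pi>\<^sub>M i\<in>K p. borel)" for k
        by (cases "alias_coeff n j q k = 0") (auto simp: p K_def intro!: measurable_component_singleton)
      then show ?thesis
        unfolding p F_def prod.case
        by (intro borel_measurable_suminf borel_measurable_times borel_measurable_const)
    qed
    show "(\<lambda>(j, q, t) \<omega>. \<Sum>k. alias_coeff n j q k * coeff (coeff_index q t k) \<omega>) p \<omega> =
        F p (\<lambda>i\<in>K p. coeff i \<omega>)" for p \<omega>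
      by (cases p) (auto simp: F_def K_def intro!: suminf_cong)
  qed auto
  show "AE \<omega> in M. (\<lambda>(j, q, t) \<omega>. \<Sum>k. alias_coeff n j q k * coeff (coeff_index q t k) \<omega>) p \<omega> =
      (\<lambda>(j, q, t). noise n j q t) p \<omega>" if "p \<in> ?I" for p
  proof -
    obtain j q t where p: "p = (j, q, t)" by (cases p)
    from noise_series[OF assms(1), of j q t] show ?thesis
      unfolding p prod.case by eventually_elim (rule sums_unique[symmetric])
  qed
  show "random_variable borel ((\<lambda>(j, q, t). noise n j q t) p)" for p
    by (cases p) (simp add: measurable_noise)
qed auto

abbreviation avg_noise :: "nat \<Rightarrow> nat \<Rightarrow> nat \<Rightarrow> nat \<Rightarrow> 'w \<Rightarrow> real" where
  "avg_noise n T j q \<omega> \<equiv> mean_noise n (\<lambda>t \<theta>. N t \<theta> \<omega>) T j q"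

lemma measurable_avg_noise [measurable]: "random_variable borel (avg_noise n T j q)"
  unfolding mean_noise_def by measurable

text \<open>The average of \<open>T + 1\<close> independent coefficients of variance \<open>grid_var \<sigma> n j\<close> is rescaled to variance 1;
the constant \<open>c\<close> becomes the aliasing error in the main result, and 0 in the limit theorem.\<close>
lemma distr_avg_noise:
  assumes "odd n" "real j < real n / 2" "q < dof j" and v: "grid_var \<sigma> n j > 0"
  shows "distr M borel (\<lambda>\<omega>. sqrt ((real T + 1) / grid_var \<sigma> n j) * (c + avg_noise n T j q \<omega>)) =
     gaussian (sqrt ((real T + 1) / grid_var \<sigma> n j) * c) 1"
proof -
  let ?v = "grid_var \<sigma> n j"
  let ?s = "sqrt ((real T + 1) / ?v)"
  have "indep_vars (\<lambda>_. borel) (\<lambda>t. (\<lambda>(j, q, t). noise n j q t) (j, q, t)) {0..T}"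
    by (rule indep_vars_reindex_inj[OF indep_vars_noise[OF assms(1,2)]])
       (use assms in \<open>auto simp: inj_on_def\<close>)
  then have "distr M borel (\<lambda>\<omega>. \<Sum>t=0..T. noise n j q t \<omega>) = gaussian 0 (sqrt (\<Sum>t=0..T. (sqrt ?v)\<^sup>2))"
    using gaussian_sum[of "{0..T}" "noise n j q" "\<lambda>_. 0"] by (simp add: distr_noise[OF assms(1-3)])
  also have "(\<Sum>t=0..T. (sqrt ?v)\<^sup>2) = (real T + 1) * ?v" using v by simp
  finally have "distr M borel (\<lambda>\<omega>. ?s * c + ?s / (real T + 1) * (\<Sum>t=0..T. noise n j q t \<omega>)) =
      gaussian (?s * c + ?s / (real T + 1) * 0) (?s / (real T + 1) * sqrt ((real T + 1) * ?v))"
    by (intro gaussian_affine) auto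
  also have "(\<lambda>\<omega>. ?s * c + ?s / (real T + 1) * (\<Sum>t=0..T. noise n j q t \<omega>)) =
      (\<lambda>\<omega>. ?s * (c + avg_noise n T j q \<omega>))"
    by (simp add: mean_noise_def distrib_left)
  also have "?s / (real T + 1) * sqrt ((real T + 1) * ?v) = 1"
  proof -
    have "(real T + 1) / ?v * ((real T + 1) * ?v) = (real T + 1)\<^sup>2"
      using v by (simp add: power2_eq_square)
    then have "?s * sqrt ((real T + 1) * ?v) = real T + 1"
      by (simp only: real_sqrt_mult[symmetric]) simp
    then show ?thesis by (simp add: field_simps)
  qed
  finally show ?thesis by simp
qed

lemma indep_vars_avg_noise:
  assumes "odd n" "real J < real n / 2"
  shows "indep_vars (\<lambda>_. borel) (\<lambda>(j, q). avg_noise n T j q) {(j, q). j \<le> J \<and> q < dof j}"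
  by (rule indep_vars_blockwise[OF indep_vars_noise[OF assms],
        where K = "\<lambda>(j, q). {(j, q, t) | t. t \<le> T}"
          and F = "\<lambda>(j, q) x. 1 / (real T + 1) * (\<Sum>t=0..T. x (j, q, t))"])
     (auto simp: disjoint_family_on_def mean_noise_def
       intro!: borel_measurable_times borel_measurable_sum measurable_component_singleton)

lemma avg_noise_tendsto_0:
  assumes "odd n" "real j < real n / 2" "q < dof j" and v: "grid_var \<sigma> n j > 0"
  shows "AE \<omega> in M. (\<lambda>T. avg_noise n T j q \<omega>) \<longlonglongrightarrow> 0"
proof -
  let ?v = "grid_var \<sigma> n j"
  have "AE \<omega> in M. (\<lambda>T. sqrt ((real T + 1) / ?v) * (0 + avg_noise n T j q \<omega>) / sqrt (real T + 1)) \<longlonglongrightarrow> 0"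
    by (rule AE_gaussian_over_sqrt_tendsto_0) (use distr_avg_noise[OF assms, of _ 0] in simp_all)
  then show ?thesis
  proof eventually_elim
    case (elim \<omega>)
    have "sqrt ?v * (sqrt ((real T + 1) / ?v) * (0 + avg_noise n T j q \<omega>) / sqrt (real T + 1)) = avg_noise n T j q \<omega>" for T
      using v by (simp add: real_sqrt_divide)
    with tendsto_mult_right_zero[OF elim, of "sqrt ?v"] show ?case by simp
  qed
qed

end

section \<open>Decomposition and limit of the error\<close>

theorem theorem4:
  fixes M :: "'w measure"
    and \<Gamma> :: "real \<Rightarrow> real^2"
    and \<sigma> :: "nat \<Rightarrow> real"
    and A B :: "nat \<Rightarrow> nat \<Rightarrow> 2 \<Rightarrow> 'w \<Rightarrow> real"
    and N X :: "nat \<Rightarrow> real \<Rightarrow> 'w \<Rightarrow> real^2"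
    and n J :: nat
  assumes "C1_within {-pi..pi} \<Gamma>"
    and "\<Gamma> (-pi) = \<Gamma> pi"
    and "curve_noise M \<sigma> A B N"
    and "\<And>t \<theta> \<omega>. X t \<theta> \<omega> = \<Gamma> \<theta> + N t \<theta> \<omega>"
    and "n \<ge> 3" and "odd n"
    and "J \<ge> 1" and "real J < real n / 2"
    and "\<And>j. j \<le> J \<Longrightarrow> grid_var \<sigma> n j > 0"
  shows "\<exists>(Zj :: nat \<Rightarrow> nat \<Rightarrow> 'w \<Rightarrow> real) (Z :: nat \<Rightarrow> 'w \<Rightarrow> real).
    (\<forall>T \<omega>. Z T \<omega> = 1 / (real T + 1) *
        (2 * grid_var \<sigma> n 0 * Zj T 0 \<omega> + (\<Sum>j=1..J. grid_var \<sigma> n j * Zj T j \<omega>))) \<and>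
    (\<forall>T. prob_space.indep_vars M (\<lambda>_. borel) (Zj T) {0..J}) \<and>
    (\<forall>T. noncentral_chi_square 2 ((real T + 1) * aliasing n \<Gamma> 0 / grid_var \<sigma> n 0)
           (distr M borel (Zj T 0))) \<and>
    (\<forall>T. \<forall>j\<in>{1..J}. noncentral_chi_square 4 ((real T + 1) * aliasing n \<Gamma> j / grid_var \<sigma> n j)
           (distr M borel (Zj T j))) \<and>
    summable (\<lambda>j. (norm (fourier_cos \<Gamma> (J + 1 + j)))\<^sup>2 + (norm (fourier_sin \<Gamma> (J + 1 + j)))\<^sup>2) \<and>
    (\<forall>T. \<forall>\<omega>\<in>space M.
       1 / pi * integral {-pi..pi}
         (\<lambda>\<theta>. (norm (curve_estimator n J T (\<lambda>t \<phi>. X t \<phi> \<omega>) \<theta> - \<Gamma> \<theta>))\<^sup>2)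
       = (\<Sum>j. (norm (fourier_cos \<Gamma> (J + 1 + j)))\<^sup>2 + (norm (fourier_sin \<Gamma> (J + 1 + j)))\<^sup>2)
         + Z T \<omega>) \<and>
    (AE \<omega> in M. (\<lambda>T. Z T \<omega>) \<longlonglongrightarrow> 2 * aliasing n \<Gamma> 0 + (\<Sum>j=1..J. aliasing n \<Gamma> j))"
proof -
  interpret curve_noise M \<sigma> A B N by fact
  note v_pos = assms(9)
  have half: "real j < real n / 2" if "j \<le> J" for j using that assms(8) by simp
  have \<Gamma>: "continuous_on {-pi..pi} \<Gamma>"
    using assms(1) unfolding C1_within_def continuous_on_eq_continuous_within
    by (blast intro: has_vector_derivative_continuous)

  \<comment> \<open>the error of each estimated coefficient, and its version standardised to variance 1\<close>
  define err where "err T j q \<omega> = aliasing_error n \<Gamma> j q + avg_noise n T j q \<omega>" for T j q \<omega>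
  define Y where "Y T j q \<omega> = sqrt ((real T + 1) / grid_var \<sigma> n j) * err T j q \<omega>" for T j q \<omega>
  define Zj where "Zj T j \<omega> = (\<Sum>q<dof j. (Y T j q \<omega>)\<^sup>2)" for T j \<omega>
  define Z where "Z T \<omega> = 1 / (real T + 1) *
        (2 * grid_var \<sigma> n 0 * Zj T 0 \<omega> + (\<Sum>j=1..J. grid_var \<sigma> n j * Zj T j \<omega>))" for T \<omega>

  \<comment> \<open>standardisation cancels against the factors in Z\<close>
  have rescale: "1 / (real T + 1) * (grid_var \<sigma> n j * Zj T j \<omega>) = (\<Sum>q<dof j. (err T j q \<omega>)\<^sup>2)"
    if "j \<le> J" for T j \<omega>
  proof -
    have "(Y T j q \<omega>)\<^sup>2 = (real T + 1) / grid_var \<sigma> n j * (err T j q \<omega>)\<^sup>2" for q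
      using v_pos[OF that] by (simp add: Y_def power_mult_distrib)
    then have "Zj T j \<omega> = (real T + 1) / grid_var \<sigma> n j * (\<Sum>q<dof j. (err T j q \<omega>)\<^sup>2)"
      by (simp only: Zj_def sum_distrib_left)
    then show ?thesis using v_pos[OF that] by simp
  qed
  have Z_eq: "Z T \<omega> = 2 * (\<Sum>q<dof 0. (err T 0 q \<omega>)\<^sup>2) + (\<Sum>j=1..J. \<Sum>q<dof j. (err T j q \<omega>)\<^sup>2)" for T \<omega>
  proof -
    have "Z T \<omega> = 2 * (1 / (real T + 1) * (grid_var \<sigma> n 0 * Zj T 0 \<omega>))
        + (\<Sum>j=1..J. 1 / (real T + 1) * (grid_var \<sigma> n j * Zj T j \<omega>))"
      unfolding Z_def by (simp only: distrib_left sum_distrib_left mult_ac)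
    also have "\<dots> = 2 * (\<Sum>q<dof 0. (err T 0 q \<omega>)\<^sup>2) + (\<Sum>j=1..J. \<Sum>q<dof j. (err T j q \<omega>)\<^sup>2)"
      by (intro arg_cong2[of _ _ _ _ "(+)"] arg_cong2[of _ _ _ _ "(*)"] sum.cong refl rescale) auto
    finally show ?thesis .
  qed

  have indep_Y: "indep_vars (\<lambda>_. borel) (\<lambda>(j, q). Y T j q) {(j, q). j \<le> J \<and> q < dof j}" for T
  proof -
    have "indep_vars (\<lambda>_. borel) (\<lambda>p \<omega>. (\<lambda>(j, q) x. sqrt ((real T + 1) / grid_var \<sigma> n j) * (aliasing_error n \<Gamma> j q + x)) p
        ((\<lambda>(j, q). avg_noise n T j q) p \<omega>)) {(j, q). j \<le> J \<and> q < dof j}"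
      by (rule indep_vars_compose2[OF indep_vars_avg_noise[OF assms(6,8)]]) auto
    then show ?thesis by (simp add: Y_def[abs_def] err_def case_prod_unfold)
  qed
  have indep_Z: "indep_vars (\<lambda>_. borel) (Zj T) {0..J}" for T
    by (rule indep_vars_blockwise[OF indep_Y[of T],
        where K = "\<lambda>j. {(j, q) | q. q < dof j}" and F = "\<lambda>j x. \<Sum>q<dof j. (x (j, q))\<^sup>2"])
       (auto simp: disjoint_family_on_def Zj_def
         intro!: borel_measurable_power borel_measurable_sum measurable_component_singleton)
  have chi: "noncentral_chi_square (dof j) ((real T + 1) * aliasing n \<Gamma> j / grid_var \<sigma> n j) (distr M borel (Zj T j))"
    if j: "j \<le> J" for T j
  proof -
    let ?s = "sqrt ((real T + 1) / grid_var \<sigma> n j)"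
    have "indep_vars (\<lambda>_. borel) (\<lambda>q. (\<lambda>(j, q). Y T j q) (j, q)) {..<dof j}"
      by (rule indep_vars_reindex_inj[OF indep_Y]) (use j in \<open>auto simp: inj_on_def\<close>)
    then have "indep_vars (\<lambda>_. borel) (Y T j) {..<dof j}" by simp
    moreover have "distr M borel (Y T j q) = gaussian (?s * aliasing_error n \<Gamma> j q) 1" if "q < dof j" for q
      using distr_avg_noise[OF assms(6) half[OF j] that v_pos[OF j], of T "aliasing_error n \<Gamma> j q"]
      by (simp add: Y_def[abs_def] err_def)
    ultimately have "noncentral_chi_square (dof j) (\<Sum>q<dof j. (?s * aliasing_error n \<Gamma> j q)\<^sup>2)
        (distr M borel (\<lambda>\<omega>. \<Sum>q<dof j. (Y T j q \<omega>)\<^sup>2))"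
      by (intro noncentral_chi_square_sum_squares) (simp_all add: dof_def)
    also have "(\<Sum>q<dof j. (?s * aliasing_error n \<Gamma> j q)\<^sup>2) = (real T + 1) * aliasing n \<Gamma> j / grid_var \<sigma> n j"
      using v_pos[OF j]
      by (simp add: power_mult_distrib aliasing_eq_sum sum_distrib_left sum_divide_distrib)
    finally show ?thesis by (simp add: Zj_def[abs_def])
  qed

  have sums: "(\<lambda>j. (norm (fourier_cos \<Gamma> (J + 1 + j)))\<^sup>2 + (norm (fourier_sin \<Gamma> (J + 1 + j)))\<^sup>2) sums
    (1 / pi * integral {-pi..pi}
         (\<lambda>\<theta>. (norm (curve_estimator n J T (\<lambda>t \<phi>. X t \<phi> \<omega>) \<theta> - \<Gamma> \<theta>))\<^sup>2) - Z T \<omega>)" for T \<omega>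
    using integrated_square_error[OF \<Gamma> assms(2), of J n T "\<lambda>t \<theta>. N t \<theta> \<omega>"]
    by (simp add: assms(4) Z_eq err_def)

  have "AE \<omega> in M. \<forall>p\<in>(SIGMA j:{0..J}. {..<dof j}). (\<lambda>T. avg_noise n T (fst p) (snd p) \<omega>) \<longlonglongrightarrow> 0"
    using half assms(6) v_pos by (intro AE_finite_allI) (auto intro!: avg_noise_tendsto_0)
  then have limit: "AE \<omega> in M. (\<lambda>T. Z T \<omega>) \<longlonglongrightarrow> 2 * aliasing n \<Gamma> 0 + (\<Sum>j=1..J. aliasing n \<Gamma> j)"
  proof eventually_elim
    case (elim \<omega>)
    have "(\<lambda>T. err T j q \<omega>) \<longlonglongrightarrow> aliasing_error n \<Gamma> j q" if "j \<le> J" "q < dof j" for j q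
      using elim that tendsto_add[OF tendsto_const, of "\<lambda>T. avg_noise n T j q \<omega>" 0 sequentially "aliasing_error n \<Gamma> j q"]
      by (auto simp: err_def)
    then show ?case unfolding Z_eq aliasing_eq_sum by (intro tendsto_intros) auto
  qed
  show ?thesis
  proof (intro exI[of _ Zj] exI[of _ Z] conjI allI ballI)
    show "noncentral_chi_square 2 ((real T + 1) * aliasing n \<Gamma> 0 / grid_var \<sigma> n 0) (distr M borel (Zj T 0))" for T
      using chi[of 0 T] by (simp add: dof_def)
    show "noncentral_chi_square 4 ((real T + 1) * aliasing n \<Gamma> j / grid_var \<sigma> n j) (distr M borel (Zj T j))"
      if "j \<in> {1..J}" for T j
      using chi[of j T] that by (simp add: dof_def)
    show "1 / pi * integral {-pi..pi}
         (\<lambda>\<theta>. (norm (curve_estimator n J T (\<lambda>t \<phi>. X t \<phi> \<omega>) \<theta> - \<Gamma> \<theta>))\<^sup>2)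
       = (\<Sum>j. (norm (fourier_cos \<Gamma> (J + 1 + j)))\<^sup>2 + (norm (fourier_sin \<Gamma> (J + 1 + j)))\<^sup>2)
         + Z T \<omega>" for T \<omega>
      unfolding sums_unique[OF sums[of T \<omega>], symmetric] by simp
  qed (fact indep_Z limit Z_def sums_summable[OF sums])+
qed

end
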